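(* Let $K$ be a compact metrizable hypergroup and let $1<p\le 2$. Let $\pi\mapsto\mu_\pi$ be a positive function on $\widehat K$ such that $$\sum_{\pi\in\widehat K}\frac{k_\pi^2}{|\mu_\pi|^{\beta}}<\infty\quad\text{for some }\beta\ge 0 .$$ Then there is a constant $C>0$, independent of $f$, such that for all $f\in L^p(K)$ $$\sum_{\pi\in\widehat K}k_\pi^2\,|\mu_\pi|^{\beta(p-2)}\left(\frac{\|\widehat f(\pi)\|_{\mathrm{HS}}}{\sqrt{k_\pi}}\right)^p\le C\,\|f\|_{L^p(K)}^p .$$
   Context: A compact hypergroup is a nonempty compact Hausdorff space $K$ with a weakly continuous associative convolution $*$ on the Banach space $M(K)$ of bounded regular (complex) Borel measures, making $(M(K),* )$ a Banach algebra, such that: (i) for $x,y\in K$, $\delta_x*\delta_y$ is a probability measure with compact support and $(x,y)\mapsto\operatorname{supp}(\delta_x*\delta_y)$ is continuous from $K\times K$ into the space of nonempty compact subsets of $K$ with the Michael (Vietoris) topology; (ii) there is a unique $e\in K$ with $\delta_x*\delta_e=\delta_e*\delta_x=\delta_x$ for all $x$; (iii) there is a homeomorphism $x\mapsto\check x$ of $K$ of order two inducing an involution on $M(K)$, where $\check\mu(E)=\mu(\check E)$ for Borel $E$, and $e\in\operatorname{supp}(\delta_x*\delta_y)$ if and only if $x=\check y$. $\lambda$ denotes the normalized Haar measure of $K$ (the left-invariant one: $\int_K f(x*y)\,d\lambda(y)=\int_K f(y)\,d\lambda(y)$ for all $x\in K$ and continuous $f$, where $f(x*y)=\int f\,d(\delta_x*\delta_y)$),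 and $L^p(K)=L^p(K,\lambda)$. $\widehat K$ is the set of equivalence classes of irreducible representations of $K$, i.e. irreducible $*$-algebra representations $\pi$ of $M(K)$ on a Hilbert space $\mathcal H_\pi$ with $\pi(\delta_e)=I$ and $\mu\mapsto\langle\pi(\mu)u,v\rangle$ continuous on the cone $M(K)^+$ of positive measures with the weak topology; write $\pi(x)=\pi(\delta_x)$. All such $\pi$ are finite dimensional; $d_\pi=\dim\mathcal H_\pi$, and $\pi(x)=[\pi_{i,j}(x)]$ is the matrix in a fixed orthonormal basis. $\widehat K$ is countable since $K$ is metrizable. The hyperdimension $k_\pi\ge d_\pi$ is the constant with $\int_K\pi_{i,j}\overline{\pi'_{m,l}}\,d\lambda=1/k_\pi$ if $i=m$, $j=l$, $\pi=\pi'$, and $0$ otherwise. The Fourier transform is $\widehat f(\pi)=\int_K f(x)\,\bar\pi(x)\,d\lambda(x)\in\mathbb C^{d_\pi\times d_\pi}$ with $\bar\pi$ the conjugate representation (entries $\overline{\pi_{i,j}}$), and $\|\cdot\|_{\mathrm{HS}}$ is the Hilbert–Schmidt norm. *)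

theory Defs
  imports "HOL-Probability.Probability"
begin

section \<open>The measure algebra of a compact space\<close>

text \<open>A complex Borel measure is rendered as a set function that vanishes, by convention, on
  non-Borel sets, so that equality of measures is equality of functions.\<close>

type_synonym 'a cmeas = "'a set \<Rightarrow> complex"

definition total_variation :: "'a::topological_space cmeas \<Rightarrow> 'a set \<Rightarrow> ennreal" where
  "total_variation \<mu> E =
    (SUP P\<in>{P. finite P \<and> disjoint P \<and> P \<subseteq> sets borel \<and> \<Union>P \<subseteq> E}. \<Sum>A\<in>P. ennreal (cmod (\<mu> A)))"

text \<open>The measure algebra $M(K)$. Boundedness needs no clause of its own: a complex-valued countably additive set
  function has finite total variation.\<close>

definition measure_algebra :: "'a::topological_space cmeas set" where
  "measure_algebra = {\<mu>.
     (\<forall>E. E \<notin> sets borel \<longrightarrow> \<mu> E = 0) \<and>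
     (\<forall>A :: nat \<Rightarrow> 'a set. range A \<subseteq> sets borel \<longrightarrow> disjoint_family A \<longrightarrow>
        (\<lambda>n. \<mu> (A n)) sums \<mu> (\<Union>n. A n)) \<and>
     (\<forall>E\<in>sets borel.
        total_variation \<mu> E = (INF U\<in>{U. open U \<and> E \<subseteq> U}. total_variation \<mu> U) \<and>
        total_variation \<mu> E = (SUP C\<in>{C. compact C \<and> C \<subseteq> E}. total_variation \<mu> C))}"

definition cm_norm :: "'a::topological_space cmeas \<Rightarrow> real" where
  "cm_norm \<mu> = enn2real (total_variation \<mu> UNIV)"

definition cm_lincomb :: "complex \<Rightarrow> 'a cmeas \<Rightarrow> 'a cmeas \<Rightarrow> 'a cmeas" where
  "cm_lincomb a \<mu> \<nu> = (\<lambda>E. a * \<mu> E + \<nu> E)"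

definition cm_of :: "'a measure \<Rightarrow> 'a cmeas" where
  "cm_of M = (\<lambda>E. complex_of_real (measure M E))"

definition dirac :: "'a::topological_space \<Rightarrow> 'a cmeas" where
  "dirac x = cm_of (return borel x)"

definition positive_cone :: "'a::topological_space cmeas set" where
  "positive_cone = {\<mu> \<in> measure_algebra. \<forall>E. \<mu> E \<in> \<real> \<and> 0 \<le> Re (\<mu> E)}"

text \<open>The library measure of a member of the positive cone (inverse to \<^const>\<open>cm_of\<close>), used to
  integrate against it.\<close>

definition to_measure :: "'a::topological_space cmeas \<Rightarrow> 'a measure" where
  "to_measure \<mu> = measure_of UNIV (sets borel) (\<lambda>E. ennreal (Re (\<mu> E)))"

text \<open>The weak topology on the positive cone: the initial topology for the maps
  $\mu \mapsto \int f\,d\mu$ with $f$ a continuous real function on the (compact) space.\<close>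

definition weak_topology :: "'a::topological_space cmeas topology" where
  "weak_topology =
    pullback_topology positive_cone
      (\<lambda>\<mu>. \<lambda>f\<in>{f. continuous_on UNIV f}. integral\<^sup>L (to_measure \<mu>) f)
      (product_topology (\<lambda>_. euclideanreal) {f. continuous_on UNIV f})"

definition cm_supp :: "'a::topological_space cmeas \<Rightarrow> 'a set" where
  "cm_supp \<mu> = {x. \<forall>U. open U \<longrightarrow> x \<in> U \<longrightarrow> total_variation \<mu> U \<noteq> 0}"

definition vietoris_topology :: "'a::topological_space set topology" where
  "vietoris_topology = topology_generated_by
     ({{C. compact C \<and> C \<noteq> {} \<and> C \<inter> U \<noteq> {}} |U. open U} \<union>
      {{C. compact C \<and> C \<noteq> {} \<and> C \<subseteq> U} |U. open U})"


section \<open>Compact hypergroups\<close>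

definition cm_check :: "('a \<Rightarrow> 'a) \<Rightarrow> 'a cmeas \<Rightarrow> 'a cmeas" where
  "cm_check chk \<mu> = (\<lambda>E. \<mu> (chk ` E))"

text \<open>The Hilbert-space adjoint on representations corresponds to the conjugate-linear involution
  $\mu^*(E) = \overline{\mu(\check E)}$ of $M(K)$, not to the linear map $\mu \mapsto \check\mu$.\<close>

definition cm_star :: "('a \<Rightarrow> 'a) \<Rightarrow> 'a cmeas \<Rightarrow> 'a cmeas" where
  "cm_star chk \<mu> = (\<lambda>E. cnj (\<mu> (chk ` E)))"

text \<open>Weak continuity of the convolution is joint continuity on the positive cone (Jewett's
  ``positive-continuity''); on all of $M(K)$ convolution is not jointly weakly continuous, not even
  for the circle group. ``Order two'' means that the check map is its own inverse; it may be the
  identity.\<close>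

locale compact_hypergroup =
  fixes conv :: "'a::t2_space cmeas \<Rightarrow> 'a cmeas \<Rightarrow> 'a cmeas"
    and chk :: "'a \<Rightarrow> 'a"
    and e :: 'a
  assumes compact_UNIV: "compact (UNIV :: 'a set)"
    and conv_closed:
      "\<And>\<mu> \<nu>. \<mu> \<in> measure_algebra \<Longrightarrow> \<nu> \<in> measure_algebra \<Longrightarrow> conv \<mu> \<nu> \<in> measure_algebra"
    and conv_lincomb_left:
      "\<And>a \<mu> \<mu>' \<nu>. \<mu> \<in> measure_algebra \<Longrightarrow> \<mu>' \<in> measure_algebra \<Longrightarrow> \<nu> \<in> measure_algebra \<Longrightarrow>
         conv (cm_lincomb a \<mu> \<mu>') \<nu> = cm_lincomb a (conv \<mu> \<nu>) (conv \<mu>' \<nu>)"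
    and conv_lincomb_right:
      "\<And>a \<mu> \<nu> \<nu>'. \<mu> \<in> measure_algebra \<Longrightarrow> \<nu> \<in> measure_algebra \<Longrightarrow> \<nu>' \<in> measure_algebra \<Longrightarrow>
         conv \<mu> (cm_lincomb a \<nu> \<nu>') = cm_lincomb a (conv \<mu> \<nu>) (conv \<mu> \<nu>')"
    and conv_assoc:
      "\<And>\<mu> \<nu> \<rho>. \<mu> \<in> measure_algebra \<Longrightarrow> \<nu> \<in> measure_algebra \<Longrightarrow> \<rho> \<in> measure_algebra \<Longrightarrow>
         conv (conv \<mu> \<nu>) \<rho> = conv \<mu> (conv \<nu> \<rho>)"
    and conv_norm:
      "\<And>\<mu> \<nu>. \<mu> \<in> measure_algebra \<Longrightarrow> \<nu> \<in> measure_algebra \<Longrightarrow>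
         cm_norm (conv \<mu> \<nu>) \<le> cm_norm \<mu> * cm_norm \<nu>"
    and conv_weakly_continuous:
      "continuous_map (prod_topology weak_topology weak_topology) weak_topology
         (\<lambda>(\<mu>, \<nu>). conv \<mu> \<nu>)"
    and conv_dirac_prob:
      "\<And>x y. conv (dirac x) (dirac y) \<in> positive_cone \<and> conv (dirac x) (dirac y) UNIV = 1"
    and conv_dirac_supp_compact:
      "\<And>x y. compact (cm_supp (conv (dirac x) (dirac y)))"
    and conv_dirac_supp_continuous:
      "continuous_map (prod_topology euclidean euclidean) vietoris_topology
         (\<lambda>(x, y). cm_supp (conv (dirac x) (dirac y)))"
    and unique_identity:
      "\<And>e'. (\<forall>x. conv (dirac x) (dirac e') = dirac x \<and> conv (dirac e') (dirac x) = dirac x)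
         \<longleftrightarrow> e' = e"
    and chk_homeomorphism: "homeomorphism UNIV UNIV chk chk"
    and chk_involution:
      "\<And>\<mu> \<nu>. \<mu> \<in> measure_algebra \<Longrightarrow> \<nu> \<in> measure_algebra \<Longrightarrow>
         cm_check chk (conv \<mu> \<nu>) = conv (cm_check chk \<nu>) (cm_check chk \<mu>)"
    and e_in_supp: "\<And>x y. e \<in> cm_supp (conv (dirac x) (dirac y)) \<longleftrightarrow> x = chk y"

definition haar_measure ::
  "('a::t2_space cmeas \<Rightarrow> 'a cmeas \<Rightarrow> 'a cmeas) \<Rightarrow> 'a measure \<Rightarrow> bool" where
  "haar_measure conv \<Lambda> \<longleftrightarrow>
     prob_space \<Lambda> \<and> sets \<Lambda> = sets borel \<and> cm_of \<Lambda> \<in> measure_algebra \<and>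
     (\<forall>x. \<forall>f :: 'a \<Rightarrow> complex. continuous_on UNIV f \<longrightarrow>
        (\<integral>y. (\<integral>z. f z \<partial>to_measure (conv (dirac x) (dirac y))) \<partial>\<Lambda>) = (\<integral>y. f y \<partial>\<Lambda>))"


section \<open>Representations and the dual\<close>

text \<open>Hilbert spaces are modelled by $\ell^2(I)$ with $I \subseteq \mathbb N$, of dimension
  $|I|$. These are all the separable Hilbert spaces up to unitary equivalence, and an irreducible
  representation of a metrizable $K$ acts on a separable space: it is determined by the operators
  $\pi(x)$, which depend weakly continuously on $x$. A representation is a pair of the index set
  and the action of $M(K)$.\<close>

definition ell2 :: "nat set \<Rightarrow> (nat \<Rightarrow> complex) set" where
  "ell2 I = {v. (\<forall>n. n \<notin> I \<longrightarrow> v n = 0) \<and> summable (\<lambda>n. (cmod (v n))\<^sup>2)}"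

definition ell2_inner :: "(nat \<Rightarrow> complex) \<Rightarrow> (nat \<Rightarrow> complex) \<Rightarrow> complex" where
  "ell2_inner u v = (\<Sum>n. u n * cnj (v n))"

definition ell2_norm :: "(nat \<Rightarrow> complex) \<Rightarrow> real" where
  "ell2_norm v = sqrt (\<Sum>n. (cmod (v n))\<^sup>2)"

definition unit_vec :: "nat \<Rightarrow> nat \<Rightarrow> complex" where
  "unit_vec j = (\<lambda>n. if n = j then 1 else 0)"

definition linear_ell2 ::
  "nat set \<Rightarrow> nat set \<Rightarrow> ((nat \<Rightarrow> complex) \<Rightarrow> (nat \<Rightarrow> complex)) \<Rightarrow> bool" where
  "linear_ell2 I J T \<longleftrightarrow>
     T ` ell2 I \<subseteq> ell2 J \<and>
     (\<forall>u\<in>ell2 I. \<forall>v\<in>ell2 I. \<forall>a. T (\<lambda>n. a * u n + v n) = (\<lambda>n. a * T u n + T v n))"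

definition bounded_operator ::
  "nat set \<Rightarrow> ((nat \<Rightarrow> complex) \<Rightarrow> (nat \<Rightarrow> complex)) \<Rightarrow> bool" where
  "bounded_operator I T \<longleftrightarrow>
     linear_ell2 I I T \<and> (\<exists>B. \<forall>v\<in>ell2 I. ell2_norm (T v) \<le> B * ell2_norm v)"

definition closed_subspace :: "nat set \<Rightarrow> (nat \<Rightarrow> complex) set \<Rightarrow> bool" where
  "closed_subspace I W \<longleftrightarrow>
     W \<subseteq> ell2 I \<and> (\<lambda>n. 0) \<in> W \<and>
     (\<forall>u\<in>W. \<forall>v\<in>W. \<forall>a. (\<lambda>n. a * u n + v n) \<in> W) \<and>
     (\<forall>w v. (\<forall>m. w m \<in> W) \<longrightarrow> v \<in> ell2 I \<longrightarrow>
        (\<lambda>m. ell2_norm (\<lambda>n. w m n - v n)) \<longlonglongrightarrow> 0 \<longrightarrow> v \<in> W)"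

type_synonym 'a rep = "nat set \<times> ('a cmeas \<Rightarrow> (nat \<Rightarrow> complex) \<Rightarrow> (nat \<Rightarrow> complex))"

definition representation ::
  "('a::t2_space cmeas \<Rightarrow> 'a cmeas \<Rightarrow> 'a cmeas) \<Rightarrow> ('a \<Rightarrow> 'a) \<Rightarrow> 'a \<Rightarrow> 'a rep \<Rightarrow> bool" where
  "representation conv chk e = (\<lambda>(I, \<pi>).
     (\<forall>\<mu>\<in>measure_algebra. bounded_operator I (\<pi> \<mu>)) \<and>
     (\<forall>\<mu>\<in>measure_algebra. \<forall>\<nu>\<in>measure_algebra. \<forall>a. \<forall>v\<in>ell2 I.
        \<pi> (cm_lincomb a \<mu> \<nu>) v = (\<lambda>n. a * \<pi> \<mu> v n + \<pi> \<nu> v n)) \<and>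
     (\<forall>\<mu>\<in>measure_algebra. \<forall>\<nu>\<in>measure_algebra. \<forall>v\<in>ell2 I.
        \<pi> (conv \<mu> \<nu>) v = \<pi> \<mu> (\<pi> \<nu> v)) \<and>
     (\<forall>\<mu>\<in>measure_algebra. \<forall>u\<in>ell2 I. \<forall>v\<in>ell2 I.
        ell2_inner (\<pi> (cm_star chk \<mu>) u) v = ell2_inner u (\<pi> \<mu> v)) \<and>
     (\<forall>v\<in>ell2 I. \<pi> (dirac e) v = v) \<and>
     (\<forall>u\<in>ell2 I. \<forall>v\<in>ell2 I.
        continuous_map weak_topology euclidean (\<lambda>\<mu>. ell2_inner (\<pi> \<mu> u) v)))"

definition irreducible_rep :: "'a::t2_space rep \<Rightarrow> bool" where
  "irreducible_rep = (\<lambda>(I, \<pi>).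
     I \<noteq> {} \<and>
     (\<forall>W. closed_subspace I W \<longrightarrow> (\<forall>\<mu>\<in>measure_algebra. \<pi> \<mu> ` W \<subseteq> W) \<longrightarrow>
        W = {\<lambda>n. 0} \<or> W = ell2 I))"

definition irreps ::
  "('a::t2_space cmeas \<Rightarrow> 'a cmeas \<Rightarrow> 'a cmeas) \<Rightarrow> ('a \<Rightarrow> 'a) \<Rightarrow> 'a \<Rightarrow> 'a rep set" where
  "irreps conv chk e = {\<rho>. representation conv chk e \<rho> \<and> irreducible_rep \<rho>}"

definition unitarily_equivalent :: "'a::t2_space rep \<Rightarrow> 'a rep \<Rightarrow> bool" where
  "unitarily_equivalent = (\<lambda>(I, \<pi>) (J, \<sigma>).
     \<exists>U. linear_ell2 I J U \<and> U ` ell2 I = ell2 J \<and>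
       (\<forall>u\<in>ell2 I. \<forall>v\<in>ell2 I. ell2_inner (U u) (U v) = ell2_inner u v) \<and>
       (\<forall>\<mu>\<in>measure_algebra. \<forall>v\<in>ell2 I. U (\<pi> \<mu> v) = \<sigma> \<mu> (U v)))"

definition dual ::
  "('a::t2_space cmeas \<Rightarrow> 'a cmeas \<Rightarrow> 'a cmeas) \<Rightarrow> ('a \<Rightarrow> 'a) \<Rightarrow> 'a \<Rightarrow> 'a rep set set" where
  "dual conv chk e =
     irreps conv chk e //
       {(\<rho>, \<sigma>). \<rho> \<in> irreps conv chk e \<and> \<sigma> \<in> irreps conv chk e \<and> unitarily_equivalent \<rho> \<sigma>}"

text \<open>Choosing a member of a class fixes both a representation and an orthonormal basis, the
  standard basis of its $\ell^2(I)$. The matrix indices range over \<^term>\<open>dual_index c\<close>, and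
  \<^term>\<open>dual_entry c i j x\<close> is $\pi_{i,j}(x) = \langle \pi(\delta_x) e_j, e_i\rangle$.\<close>

definition dual_rep :: "'a::t2_space rep set \<Rightarrow> 'a rep" where
  "dual_rep c = (SOME \<rho>. \<rho> \<in> c)"

definition dual_index :: "'a::t2_space rep set \<Rightarrow> nat set" where
  "dual_index c = fst (dual_rep c)"

definition dual_entry :: "'a::t2_space rep set \<Rightarrow> nat \<Rightarrow> nat \<Rightarrow> 'a \<Rightarrow> complex" where
  "dual_entry c i j x = ell2_inner (snd (dual_rep c) (dirac x) (unit_vec j)) (unit_vec i)"

text \<open>The hyperdimensions $k_\pi$ are the positive constants in the orthogonality relations. These
  relations force $\dim \mathcal H_\pi \le k_\pi < \infty$: each $\pi(x)$ is a contraction, so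
  integrating $\sum_{i \in F} |\pi_{i,j}(x)|^2 \le 1$ gives $|F| \le k_\pi$ for every finite set
  $F$ of indices.\<close>

definition hyperdimension ::
  "'a::t2_space measure \<Rightarrow> 'a rep set set \<Rightarrow> ('a rep set \<Rightarrow> real) \<Rightarrow> bool" where
  "hyperdimension \<Lambda> D k \<longleftrightarrow>
     (\<forall>c\<in>D. 0 < k c) \<and>
     (\<forall>c\<in>D. \<forall>c'\<in>D. \<forall>i\<in>dual_index c. \<forall>j\<in>dual_index c. \<forall>m\<in>dual_index c'. \<forall>l\<in>dual_index c'.
        (\<integral>x. dual_entry c i j x * cnj (dual_entry c' m l x) \<partial>\<Lambda>) =
          (if c = c' \<and> i = m \<and> j = l then complex_of_real (1 / k c) else 0))"


section \<open>Fourier transform and Lebesgue spaces\<close>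

definition fourier ::
  "'a::t2_space measure \<Rightarrow> ('a \<Rightarrow> complex) \<Rightarrow> 'a rep set \<Rightarrow> nat \<Rightarrow> nat \<Rightarrow> complex" where
  "fourier \<Lambda> f c i j = (\<integral>x. f x * cnj (dual_entry c i j x) \<partial>\<Lambda>)"

definition hs_norm :: "nat set \<Rightarrow> (nat \<Rightarrow> nat \<Rightarrow> complex) \<Rightarrow> real" where
  "hs_norm I A = sqrt (\<Sum>i\<in>I. \<Sum>j\<in>I. (cmod (A i j))\<^sup>2)"

definition Lp_space :: "real \<Rightarrow> 'a measure \<Rightarrow> ('a \<Rightarrow> complex) set" where
  "Lp_space p M = {f \<in> borel_measurable M. integrable M (\<lambda>x. cmod (f x) powr p)}"

definition Lp_norm :: "real \<Rightarrow> 'a measure \<Rightarrow> ('a \<Rightarrow> complex) \<Rightarrow> real" where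
  "Lp_norm p M f = (\<integral>x. cmod (f x) powr p \<partial>M) powr (1 / p)"

end

theory Submission
  imports Defs
begin

text \<open>For $y > 0$ split $f$ at height $y$. Each $\pi(x)$ is a contraction, so $d_\pi \le k_\pi$ and
  $\|\widehat f(\pi)\|_{HS} \le \sqrt{k_\pi}\, \|f\|_1$; Bessel's inequality gives
  $\sum_\pi k_\pi \|\widehat f(\pi)\|_{HS}^2 \le \|f\|_2^2$. The former makes
  $f \mapsto \mu_\pi^\beta \|\widehat f(\pi)\|_{HS} / \sqrt{k_\pi}$ of weak type $(1,1)$ and the latter of type
  $(2,2)$ for the weight $k_\pi^2 \mu_\pi^{-2\beta}$ on the dual, and Marcinkiewicz interpolation yields the
  inequality for $1 < p < 2$.\<close>

section \<open>Marcinkiewicz interpolation\<close>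

text \<open>A representation is only given as bounded operators on some ell^2(I), with weak
  continuity on the positive cone; neither the contraction property nor finite dimension is part of
  its definition. Contractivity has to be extracted from that continuity, and the orthogonality
  relations then make I finite. The weight is chosen to balance the endpoints. Put T f =
  \<mu>^\<beta> ||Fourier matrix|| / sqrt k and w = k^2 \<mu>^(-2\<beta>). Then w T^2 has no power
  of \<mu> left, so Bessel applies with constant 1, while w T^p is exactly the summand of the claim.
  In the (1,1) estimate one factor \<mu>^(-\<beta>) is spent on the level y, and the remaining k^2
  \<mu>^(-\<beta>) is what the hypothesis sums. All estimates run over finite sets F of classes with
  constants independent of F, so summability over the dual falls out at the end.\<close>

lemma nn_integral_powr_Ioo:
  fixes a q :: real
  assumes "0 \<le> a" "0 < q"
  shows "(\<integral>\<^sup>+y. ennreal (y powr (q - 1)) * indicator {0<..<a} y \<partial>lborel) = ennreal (a powr q / q)"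
proof -
  have "((\<lambda>y. y powr (q - 1)) has_integral (a powr q / q)) {0..a}"
    using has_integral_powr_from_0[of "q - 1" a] assms by simp
  then have "((\<lambda>y. y powr (q - 1)) has_integral (a powr q / q)) {0<..<a}"
    by (simp add: has_integral_Icc_iff_Ioo)
  from nn_integral_has_integral_lebesgue[OF _ this] show ?thesis
    by (simp add: mult.commute ennreal_mult flip: ennreal_indicator)
qed

text \<open>Applied with q = p - 2: convergence at infinity is where p < 2 enters, and it leaves the
  factor 1/(2 - p) in the constant.\<close>

lemma nn_integral_powr_Ici:
  fixes a q :: real
  assumes "0 < a" "q < 0"
  shows "(\<integral>\<^sup>+y. ennreal (y powr (q - 1)) * indicator {a..} y \<partial>lborel) = ennreal (a powr q / - q)"
proof -
  have "((\<lambda>y. y powr (q - 1)) has_integral (a powr q / - q)) {a..}"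
    using has_integral_powr_to_inf[of "q - 1" a] assms by simp
  from nn_integral_has_integral_lebesgue[OF _ this] show ?thesis
    by (simp add: mult.commute ennreal_mult flip: ennreal_indicator)
qed

text \<open>If T f c > 2y, then T exceeds y on one of the two truncations of f at height y. The weak
  bounds on these are integrated against p y^(p-1) dy and the order of integration is exchanged.
  Halving T f costs the factor 2^p. Subadditivity is asked only for the splittings of f, so T need
  not be linear.\<close>

lemma marcinkiewicz_interpolation_1_2:
  fixes f :: "'a \<Rightarrow> complex" and T :: "('a \<Rightarrow> complex) \<Rightarrow> 'b \<Rightarrow> real" and w :: "'b \<Rightarrow> real"
  assumes "sigma_finite_measure M"
    and f[measurable]: "f \<in> borel_measurable M" and fp: "integrable M (\<lambda>x. cmod (f x) powr p)"
    and p: "1 < p" "p < 2" and "finite F" and w: "\<And>c. c \<in> F \<Longrightarrow> 0 \<le> w c"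
    and A: "0 \<le> A" and B: "0 \<le> B"
    and Tf: "\<And>c. c \<in> F \<Longrightarrow> 0 \<le> T f c"
    and sublinear: "\<And>c y. c \<in> F \<Longrightarrow> 0 < y \<Longrightarrow>
      T f c \<le> T (\<lambda>x. if y < cmod (f x) then f x else 0) c
            + T (\<lambda>x. if cmod (f x) \<le> y then f x else 0) c"
    and weak1: "\<And>h y. integrable M h \<Longrightarrow> 0 < y \<Longrightarrow>
      (\<Sum>c\<in>{c\<in>F. y < T h c}. w c) \<le> A / y * (\<integral>x. cmod (h x) \<partial>M)"
    and weak2: "\<And>h y. h \<in> borel_measurable M \<Longrightarrow> integrable M (\<lambda>x. (cmod (h x))\<^sup>2) \<Longrightarrow> 0 < y \<Longrightarrow>
      (\<Sum>c\<in>{c\<in>F. y < T h c}. w c) \<le> B / y\<^sup>2 * (\<integral>x. (cmod (h x))\<^sup>2 \<partial>M)"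
  shows "(\<Sum>c\<in>F. w c * T f c powr p)
    \<le> 2 powr p * p * (A / (p - 1) + B / (2 - p)) * (\<integral>x. cmod (f x) powr p \<partial>M)"
proof -
  interpret M: sigma_finite_measure M by fact
  interpret pair_sigma_finite M lborel ..
  \<comment> \<open>For y > 0 this is the w-mass of the set where T f exceeds 2y.\<close>
  define N where "N y = (\<Sum>c\<in>F. w c * indicator {0<..<T f c / 2} y)" for y :: real
  \<comment> \<open>p y^(p-1) times the integrand of the weak-type bound on \<open>N y\<close>: A/y
    |f| on the high part, B/y^2 |f|^2 on the low part. Integrating over x bounds p y^(p-1)
    \<open>N y\<close>; integrating over y gives an explicit multiple of |f x|^p.\<close>
  define G where "G x y = ennreal (p * A * cmod (f x) * y powr (p - 2)) * indicator {0<..<cmod (f x)} y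
      + ennreal (p * B * (cmod (f x))\<^sup>2 * y powr (p - 3)) * (if 0 < y \<and> cmod (f x) \<le> y then 1 else 0)"
    for x y
  have G_meas[measurable]: "(\<lambda>(x, y). G x y) \<in> borel_measurable (M \<Otimes>\<^sub>M lborel)"
    unfolding G_def indicator_def by simp
  have N_bound: "N y \<le> A / y * (\<integral>x. cmod (if y < cmod (f x) then f x else 0) \<partial>M)
      + B / y\<^sup>2 * (\<integral>x. (cmod (if cmod (f x) \<le> y then f x else 0))\<^sup>2 \<partial>M)"
    and hi: "integrable M (\<lambda>x. if y < cmod (f x) then f x else 0)"
    and lo: "integrable M (\<lambda>x. (cmod (if cmod (f x) \<le> y then f x else 0))\<^sup>2)"
    if y: "0 < y" for y
  proof -
    let ?h = "\<lambda>x. if y < cmod (f x) then f x else 0" and ?l = "\<lambda>x. if cmod (f x) \<le> y then f x else 0"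
    \<comment> \<open>The exponent 1 - p is negative, so |f|^(1-p) is largest at the lower end |f| =
      y. For the low part below, 2 - p is positive and |f|^(2-p) is largest at the upper end. Hence
      an L^p function splits into an L^1 and an L^2 piece.\<close>
    have h1: "cmod (?h x) \<le> y powr (1 - p) * cmod (f x) powr p" for x
    proof (cases "y < cmod (f x)")
      case True
      have "cmod (f x) = cmod (f x) powr (1 - p) * cmod (f x) powr p"
        using True y by (simp flip: powr_add)
      also have "\<dots> \<le> y powr (1 - p) * cmod (f x) powr p"
        using True y p by (intro mult_right_mono powr_mono2') auto
      finally show ?thesis using True by simp
    qed simp
    show hi: "integrable M ?h"
      by (rule Bochner_Integration.integrable_bound[OF integrable_mult_right[OF fp, of "y powr (1 - p)"]])
         (use h1 in \<open>auto intro!: AE_I2 simp: abs_mult\<close>)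
    have l1: "(cmod (?l x))\<^sup>2 \<le> y powr (2 - p) * cmod (f x) powr p" for x
    proof (cases "cmod (f x) \<le> y \<and> f x \<noteq> 0")
      case True
      have "(cmod (f x))\<^sup>2 = cmod (f x) powr (2 - p) * cmod (f x) powr p"
        using True y by (simp flip: powr_add)
      also have "\<dots> \<le> y powr (2 - p) * cmod (f x) powr p"
        using True y p by (intro mult_right_mono powr_mono2) auto
      finally show ?thesis using True by simp
    qed auto
    show lo: "integrable M (\<lambda>x. (cmod (?l x))\<^sup>2)"
      by (rule Bochner_Integration.integrable_bound[OF integrable_mult_right[OF fp, of "y powr (2 - p)"]])
         (use l1 in \<open>auto intro!: AE_I2 simp: abs_mult\<close>)
    have "N y \<le> (\<Sum>c\<in>F. w c * indicator {c\<in>F. y < T ?h c} c + w c * indicator {c\<in>F. y < T ?l c} c)"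
      unfolding N_def
    proof (rule sum_mono)
      fix c assume c: "c \<in> F"
      show "w c * indicator {0<..<T f c / 2} y
        \<le> w c * indicator {c\<in>F. y < T ?h c} c + w c * indicator {c\<in>F. y < T ?l c} c"
        using sublinear[OF c y] w[OF c] y c by (auto simp: indicator_def)
    qed
    also have "\<dots> = (\<Sum>c\<in>{c\<in>F. y < T ?h c}. w c) + (\<Sum>c\<in>{c\<in>F. y < T ?l c}. w c)"
      using \<open>finite F\<close> by (simp add: sum.distrib indicator_def sum.If_cases Int_def cong: if_cong)
    finally show "N y \<le> A / y * (\<integral>x. cmod (?h x) \<partial>M) + B / y\<^sup>2 * (\<integral>x. (cmod (?l x))\<^sup>2 \<partial>M)"
      using weak1[OF hi y] weak2[OF _ lo y] by simp
  qed
  have pointwise: "ennreal (p * y powr (p - 1) * N y) \<le> (\<integral>\<^sup>+x. G x y \<partial>M)" for y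
  proof (cases "0 < y")
    case False
    then have "N y = 0" by (auto simp: N_def indicator_def)
    then show ?thesis by simp
  next
    case y: True
    let ?h = "\<lambda>x. if y < cmod (f x) then f x else 0" and ?l = "\<lambda>x. if cmod (f x) \<le> y then f x else 0"
    have "p * y powr (p - 1) * N y
      \<le> p * y powr (p - 1) * (A / y * (\<integral>x. cmod (?h x) \<partial>M) + B / y\<^sup>2 * (\<integral>x. (cmod (?l x))\<^sup>2 \<partial>M))"
      using N_bound[OF y] p by (intro mult_left_mono) auto
    also have "\<dots> = (\<integral>x. p * A * y powr (p - 2) * cmod (?h x) \<partial>M) + (\<integral>x. p * B * y powr (p - 3) * (cmod (?l x))\<^sup>2 \<partial>M)"
    proof -
      have *: "y powr (p - 2) = y powr (p - 1) / y" "y powr (p - 3) = y powr (p - 1) / y\<^sup>2"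
        using powr_diff[of y "p - 1" 1] powr_diff[of y "p - 1" 2] y by simp_all
      show ?thesis unfolding * by (simp add: field_simps)
    qed
    finally have "ennreal (p * y powr (p - 1) * N y) \<le>
      ennreal (\<integral>x. p * A * y powr (p - 2) * cmod (?h x) \<partial>M) + ennreal (\<integral>x. p * B * y powr (p - 3) * (cmod (?l x))\<^sup>2 \<partial>M)"
      using p A B by (subst ennreal_plus[symmetric]) (auto intro!: mult_nonneg_nonneg integral_nonneg_AE ennreal_leI simp del: ennreal_plus)
    also have "ennreal (\<integral>x. p * A * y powr (p - 2) * cmod (?h x) \<partial>M)
      = (\<integral>\<^sup>+x. ennreal (p * A * y powr (p - 2) * cmod (?h x)) \<partial>M)"
      using p A by (intro nn_integral_eq_integral[symmetric] integrable_mult_right integrable_norm hi y) auto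
    also have "ennreal (\<integral>x. p * B * y powr (p - 3) * (cmod (?l x))\<^sup>2 \<partial>M)
      = (\<integral>\<^sup>+x. ennreal (p * B * y powr (p - 3) * (cmod (?l x))\<^sup>2) \<partial>M)"
      using p B by (intro nn_integral_eq_integral[symmetric] integrable_mult_right lo y) auto
    also have "(\<integral>\<^sup>+x. ennreal (p * A * y powr (p - 2) * cmod (?h x)) \<partial>M)
        + (\<integral>\<^sup>+x. ennreal (p * B * y powr (p - 3) * (cmod (?l x))\<^sup>2) \<partial>M) = (\<integral>\<^sup>+x. G x y \<partial>M)"
      unfolding G_def using y
      by (subst nn_integral_add[symmetric]) (auto intro!: nn_integral_cong simp: indicator_def mult_ac)
    finally show ?thesis .
  qed
  \<comment> \<open>Both pieces scale alike: a a^(p-1) = a^2 a^(p-2) = a^p with a = |f x|. The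
    low-part integral over y starts at a, so a = 0 is handled apart.\<close>
  have inner: "(\<integral>\<^sup>+y. G x y \<partial>lborel) \<le> ennreal (p * (A / (p - 1) + B / (2 - p)) * cmod (f x) powr p)" for x
  proof (cases "f x = 0")
    case True
    then show ?thesis by (simp add: G_def)
  next
    case False
    let ?a = "cmod (f x)"
    have a: "0 < ?a" using False by simp
    have ge: "0 < y \<and> ?a \<le> y \<longleftrightarrow> ?a \<le> y" for y
      using a by linarith
    note inner = nn_integral_powr_Ioo[of ?a "p - 1"] nn_integral_powr_Ici[of ?a "p - 2"]
    have "(\<integral>\<^sup>+y. G x y \<partial>lborel) =
      (\<integral>\<^sup>+y. ennreal (p * A * ?a) * (ennreal (y powr (p - 1 - 1)) * indicator {0<..<?a} y)
        + ennreal (p * B * ?a\<^sup>2) * (ennreal (y powr (p - 2 - 1)) * indicator {?a..} y) \<partial>lborel)"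
      unfolding G_def ge using a p A B
      by (intro nn_integral_cong) (auto simp: indicator_def simp flip: ennreal_mult)
    also have "\<dots> = ennreal (p * A * ?a) * ennreal (?a powr (p - 1) / (p - 1))
        + ennreal (p * B * ?a\<^sup>2) * ennreal (?a powr (p - 2) / - (p - 2))"
      by (subst nn_integral_add, simp, simp, (subst nn_integral_cmult, simp)+)
        (use a p inner in simp)
    also have "\<dots> = ennreal (p * A * ?a * (?a powr (p - 1) / (p - 1)) + p * B * ?a\<^sup>2 * (?a powr (p - 2) / - (p - 2)))"
      using p A B by (simp add: ennreal_mult ennreal_plus divide_nonneg_neg flip: ennreal_mult)
    also have "p * A * ?a * (?a powr (p - 1) / (p - 1)) + p * B * ?a\<^sup>2 * (?a powr (p - 2) / - (p - 2))
        = p * (A / (p - 1) + B / (2 - p)) * ?a powr p"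
    proof -
      have *: "?a * ?a powr (p - 1) = ?a powr p" "?a\<^sup>2 * ?a powr (p - 2) = ?a powr p"
        using a by (auto simp: powr_diff)
      have "p * A * ?a * (?a powr (p - 1) / (p - 1)) + p * B * ?a\<^sup>2 * (?a powr (p - 2) / - (p - 2))
        = p * A / (p - 1) * (?a * ?a powr (p - 1)) + p * B / (2 - p) * (?a\<^sup>2 * ?a powr (p - 2))"
        by simp
      then show ?thesis unfolding * by (simp add: algebra_simps)
    qed
    finally show ?thesis by simp
  qed
  \<comment> \<open>Layer-cake formula: (T/2)^p is the integral of p y^(p-1) over 0 < y <
    T/2.\<close>
  have layer: "(\<integral>\<^sup>+y. ennreal (p * y powr (p - 1) * N y) \<partial>lborel) = ennreal (\<Sum>c\<in>F. w c * (T f c / 2) powr p)"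
  proof -
    have "(\<integral>\<^sup>+y. ennreal (p * y powr (p - 1) * N y) \<partial>lborel) =
      (\<integral>\<^sup>+y. (\<Sum>c\<in>F. ennreal (p * w c) * (ennreal (y powr (p - 1)) * indicator {0<..<T f c / 2} y)) \<partial>lborel)"
    proof (rule nn_integral_cong)
      fix y :: real
      have "ennreal (p * y powr (p - 1) * N y)
        = ennreal (\<Sum>c\<in>F. (p * w c) * (y powr (p - 1) * indicator {0<..<T f c / 2} y))"
        by (simp add: N_def sum_distrib_left mult_ac)
      also have "\<dots> = (\<Sum>c\<in>F. ennreal ((p * w c) * (y powr (p - 1) * indicator {0<..<T f c / 2} y)))"
        using w p by (subst sum_ennreal) auto
      also have "\<dots> = (\<Sum>c\<in>F. ennreal (p * w c) * (ennreal (y powr (p - 1)) * indicator {0<..<T f c / 2} y))"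
        using w p by (intro sum.cong refl) (auto simp: indicator_def simp flip: ennreal_mult)
      finally show "ennreal (p * y powr (p - 1) * N y) = \<dots>" .
    qed
    also have "\<dots> = (\<Sum>c\<in>F. ennreal (p * w c) * ennreal ((T f c / 2) powr p / p))"
    proof -
      have "(\<integral>\<^sup>+y. ennreal (p * w c) * (ennreal (y powr (p - 1)) * indicator {0<..<T f c / 2} y) \<partial>lborel)
        = ennreal (p * w c) * ennreal ((T f c / 2) powr p / p)" if "c \<in> F" for c
        by (subst nn_integral_cmult, simp)
          (use nn_integral_powr_Ioo[of "T f c / 2" p] Tf[OF that] p in simp)
      then show ?thesis by (subst nn_integral_sum) auto
    qed
    also have "\<dots> = (\<Sum>c\<in>F. ennreal (w c * (T f c / 2) powr p))"
      using p w by (intro sum.cong refl) (auto simp flip: ennreal_mult)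
    also have "\<dots> = ennreal (\<Sum>c\<in>F. w c * (T f c / 2) powr p)"
      using w by (intro sum_ennreal) auto
    finally show ?thesis .
  qed
  let ?C = "p * (A / (p - 1) + B / (2 - p))"
  have C: "0 \<le> ?C" using p A B by simp
  have "ennreal (\<Sum>c\<in>F. w c * (T f c / 2) powr p) \<le> (\<integral>\<^sup>+y. (\<integral>\<^sup>+x. G x y \<partial>M) \<partial>lborel)"
    unfolding layer[symmetric] by (intro nn_integral_mono pointwise)
  also have "\<dots> = (\<integral>\<^sup>+x. (\<integral>\<^sup>+y. G x y \<partial>lborel) \<partial>M)"
    using Fubini'[OF G_meas] by simp
  also have "\<dots> \<le> (\<integral>\<^sup>+x. ennreal (?C * cmod (f x) powr p) \<partial>M)"
    by (intro nn_integral_mono inner)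
  also have "\<dots> = ennreal (?C * (\<integral>x. cmod (f x) powr p \<partial>M))"
    using C fp by (subst nn_integral_eq_integral) auto
  finally have "(\<Sum>c\<in>F. w c * (T f c / 2) powr p) \<le> ?C * (\<integral>x. cmod (f x) powr p \<partial>M)"
    using C by (subst (asm) ennreal_le_iff) auto
  moreover have "(\<Sum>c\<in>F. w c * (T f c / 2) powr p) = (\<Sum>c\<in>F. w c * T f c powr p) / 2 powr p"
    unfolding sum_divide_distrib using Tf by (intro sum.cong refl) (simp add: powr_divide)
  ultimately show ?thesis by (simp add: field_simps)
qed

section \<open>Positive measures and the weak topology\<close>

lemma dirac_apply: "dirac x E = (if E \<in> sets borel \<and> x \<in> E then 1 else 0)"
  by (cases "E \<in> sets borel")
    (auto simp: dirac_def cm_of_def Sigma_Algebra.measure_def emeasure_notin_sets indicator_def)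

text \<open>The measure t \<delta>_x, encoded through \<open>cm_lincomb\<close> so that linearity of
  a representation applies to it directly.\<close>

definition point_mass :: "real \<Rightarrow> 'a::t2_space \<Rightarrow> 'a cmeas" where
  "point_mass t x = cm_lincomb (complex_of_real t) (dirac x) (\<lambda>_. 0)"

lemma point_mass_apply: "point_mass t x E = (if E \<in> sets borel \<and> x \<in> E then of_real t else 0)"
  by (simp add: point_mass_def cm_lincomb_def dirac_apply)

lemma point_mass_1: "point_mass 1 x = dirac x"
  by (auto simp: fun_eq_iff point_mass_apply dirac_apply)

text \<open>At most one member of a disjoint family contains x, and the family {{x}} attains the
  value. Since {x} is closed, this works for non-Borel E too.\<close>

lemma total_variation_point_mass:
  fixes x :: "'a::t2_space"
  assumes "0 \<le> t"
  shows "total_variation (point_mass t x) E = (if x \<in> E then ennreal t else 0)"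
proof (rule antisym)
  show "total_variation (point_mass t x) E \<le> (if x \<in> E then ennreal t else 0)"
    unfolding total_variation_def
  proof (rule SUP_least)
    fix P :: "'a set set"
    assume P: "P \<in> {P. finite P \<and> disjoint P \<and> P \<subseteq> sets borel \<and> \<Union>P \<subseteq> E}"
    show "(\<Sum>A\<in>P. ennreal (cmod (point_mass t x A))) \<le> (if x \<in> E then ennreal t else 0)"
    proof (cases "\<exists>A0\<in>P. x \<in> A0")
      case True
      then obtain A0 where A0: "A0 \<in> P" "x \<in> A0" by blast
      have "(\<Sum>A\<in>P. ennreal (cmod (point_mass t x A))) = (\<Sum>A\<in>{A0}. ennreal (cmod (point_mass t x A)))"
        using P A0 by (intro sum.mono_neutral_right) (auto simp: disjoint_def point_mass_apply)
      then show ?thesis using A0 P assms by (auto simp: point_mass_apply)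
    next
      case False
      then have "(\<Sum>A\<in>P. ennreal (cmod (point_mass t x A))) = 0"
        by (intro sum.neutral) (auto simp: point_mass_apply)
      then show ?thesis by simp
    qed
  qed
  show "(if x \<in> E then ennreal t else 0) \<le> total_variation (point_mass t x) E"
  proof (cases "x \<in> E")
    case True
    then show ?thesis unfolding total_variation_def using assms
      by (intro SUP_upper2[of "{{x}}"]) (auto simp: point_mass_apply disjoint_def)
  qed simp
qed

text \<open>Regularity has explicit witnesses: from outside \<open>UNIV\<close> or the open set
  \<open>- {x}\<close>, from inside the compact set \<open>{x}\<close>.\<close>

lemma point_mass_in_positive_cone:
  fixes x :: "'a::t2_space"
  assumes "0 \<le> t"
  shows "point_mass t x \<in> positive_cone"
proof -
  have add: "(\<lambda>n. point_mass t x (A n)) sums point_mass t x (\<Union>n. A n)"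
    if A: "range A \<subseteq> sets borel" "disjoint_family A" for A :: "nat \<Rightarrow> 'a set"
  proof -
    have [simp]: "(\<Union>n. A n) \<in> sets borel" "\<And>n. A n \<in> sets borel" using A by auto
    show ?thesis
    proof (cases "\<exists>n. x \<in> A n")
      case True
      then obtain n0 where n0: "x \<in> A n0" by blast
      have "x \<in> A n \<longleftrightarrow> n = n0" for n
        using A(2) n0 by (auto simp: disjoint_family_on_def)
      then show ?thesis
        using sums_single[of n0 "\<lambda>_. complex_of_real t"] n0 by (auto simp: point_mass_apply)
    qed (auto simp: point_mass_apply)
  qed
  have outer: "total_variation (point_mass t x) E
      = (INF U\<in>{U. open U \<and> E \<subseteq> U}. total_variation (point_mass t x) U)" for E
    unfolding total_variation_point_mass[OF assms]
  proof (intro antisym INF_greatest)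
    show "(INF U\<in>{U. open U \<and> E \<subseteq> U}. if x \<in> U then ennreal t else 0) \<le> (if x \<in> E then ennreal t else 0)"
    proof (cases "x \<in> E")
      case True
      then show ?thesis by (intro INF_lower2[of UNIV]) auto
    next
      case False
      then show ?thesis by (intro INF_lower2[of "- {x}"]) auto
    qed
  qed auto
  have inner: "total_variation (point_mass t x) E
      = (SUP C\<in>{C. compact C \<and> C \<subseteq> E}. total_variation (point_mass t x) C)" for E
    unfolding total_variation_point_mass[OF assms]
  proof (intro antisym SUP_least)
    show "(if x \<in> E then ennreal t else 0) \<le> (SUP C\<in>{C. compact C \<and> C \<subseteq> E}. if x \<in> C then ennreal t else 0)"
    proof (cases "x \<in> E")
      case True
      then show ?thesis by (intro SUP_upper2[of "{x}"]) auto
    qed simp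
  qed auto
  have "point_mass t x \<in> measure_algebra"
    unfolding measure_algebra_def mem_Collect_eq
    by (intro conjI allI impI ballI add outer inner) (simp add: point_mass_apply)
  then show ?thesis
    using assms by (auto simp: positive_cone_def point_mass_apply)
qed

lemma dirac_in_positive_cone: "dirac (x :: 'a::t2_space) \<in> positive_cone"
  using point_mass_in_positive_cone[of 1 x] by (simp add: point_mass_1)

lemma zero_in_positive_cone: "(\<lambda>_. 0) \<in> (positive_cone :: 'a::t2_space cmeas set)"
proof -
  have "point_mass 0 (undefined :: 'a) = (\<lambda>_. 0)"
    by (auto simp: fun_eq_iff point_mass_apply)
  then show ?thesis using point_mass_in_positive_cone[of 0 "undefined :: 'a"] by simp
qed

lemma positive_cone_subset: "positive_cone \<subseteq> measure_algebra"
  by (auto simp: positive_cone_def)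

lemma positive_cone_eq_Re: "\<sigma> \<in> positive_cone \<Longrightarrow> \<sigma> E = complex_of_real (Re (\<sigma> E))"
  by (auto simp: positive_cone_def complex_is_Real_iff complex_eq_iff)

section \<open>Library measures of the positive cone and weak convergence\<close>

lemma sets_to_measure [simp, measurable_cong]: "sets (to_measure \<sigma>) = sets borel"
  using sets.sigma_sets_eq[of "borel :: 'a::topological_space measure"] by (simp add: to_measure_def)

lemma space_to_measure [simp]: "space (to_measure \<sigma>) = UNIV"
  by (simp add: to_measure_def space_measure_of_conv)

lemma emeasure_to_measure:
  assumes \<sigma>: "\<sigma> \<in> positive_cone" and E: "E \<in> sets borel"
  shows "emeasure (to_measure \<sigma>) E = ennreal (Re (\<sigma> E))"
proof (rule emeasure_measure_of[OF to_measure_def])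
  have add: "(\<lambda>n. \<sigma> (A n)) sums \<sigma> (\<Union>n. A n)"
    if "range A \<subseteq> sets borel" "disjoint_family A" for A :: "nat \<Rightarrow> 'a set"
    using \<sigma> that by (auto simp: positive_cone_def measure_algebra_def)
  have pos: "0 \<le> Re (\<sigma> A)" for A using \<sigma> by (auto simp: positive_cone_def)
  \<comment> \<open>Countable additivity on the constant sequence of empty sets; a constant series
    converges only if its term is 0.\<close>
  have "(\<lambda>n::nat. \<sigma> {}) sums \<sigma> {}"
    using add[of "\<lambda>_. {}"] by (auto simp: disjoint_family_on_def)
  then have "\<sigma> {} = 0"
    using summable_LIMSEQ_zero[OF sums_summable, of "\<lambda>n. \<sigma> {}"] LIMSEQ_const_iff by blast
  then show "positive (sets (to_measure \<sigma>)) (\<lambda>E. ennreal (Re (\<sigma> E)))"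
    by (simp add: positive_def)
  show "countably_additive (sets (to_measure \<sigma>)) (\<lambda>E. ennreal (Re (\<sigma> E)))"
    unfolding countably_additive_def sets_to_measure
  proof (intro allI impI)
    fix A :: "nat \<Rightarrow> 'a set"
    assume "range A \<subseteq> sets borel" "disjoint_family A"
    from sums_Re[OF add[OF this]]
    show "(\<Sum>i. ennreal (Re (\<sigma> (A i)))) = ennreal (Re (\<sigma> (\<Union>i. A i)))"
      using pos by (subst suminf_ennreal2) (auto simp: sums_iff)
  qed
qed (use E in auto)

text \<open>Turns the Banach algebra inequality into one between total masses. For a positive
  measure the partition {UNIV} already attains the variation.\<close>

lemma cm_norm_positive_cone:
  assumes \<sigma>: "\<sigma> \<in> positive_cone"
  shows "cm_norm \<sigma> = Re (\<sigma> UNIV)"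
proof -
  have pos: "0 \<le> Re (\<sigma> A)" for A using \<sigma> by (auto simp: positive_cone_def)
  have "cmod (\<sigma> A) = Re (\<sigma> A)" for A
    using pos[of A] by (subst positive_cone_eq_Re[OF \<sigma>]) simp
  then have eq: "ennreal (cmod (\<sigma> A)) = emeasure (to_measure \<sigma>) A" if "A \<in> sets borel" for A
    using emeasure_to_measure[OF \<sigma> that] by simp
  have "total_variation \<sigma> UNIV = emeasure (to_measure \<sigma>) UNIV"
    unfolding total_variation_def
  proof (intro antisym SUP_least)
    fix P :: "'a set set"
    assume P: "P \<in> {P. finite P \<and> disjoint P \<and> P \<subseteq> sets borel \<and> \<Union>P \<subseteq> UNIV}"
    then have "(\<Sum>A\<in>P. ennreal (cmod (\<sigma> A))) = (\<Sum>A\<in>P. emeasure (to_measure \<sigma>) A)"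
      by (intro sum.cong eq) auto
    also have "\<dots> = emeasure (to_measure \<sigma>) (\<Union>A\<in>P. A)"
      using P by (intro sum_emeasure) (auto simp: disjoint_family_on_def disjoint_def)
    also have "\<dots> \<le> emeasure (to_measure \<sigma>) UNIV"
      by (intro emeasure_mono) auto
    finally show "(\<Sum>A\<in>P. ennreal (cmod (\<sigma> A))) \<le> emeasure (to_measure \<sigma>) UNIV" .
  next
    show "emeasure (to_measure \<sigma>) UNIV
      \<le> (SUP P\<in>{P. finite P \<and> disjoint P \<and> P \<subseteq> sets borel \<and> \<Union>P \<subseteq> UNIV}. \<Sum>A\<in>P. ennreal (cmod (\<sigma> A)))"
      by (intro SUP_upper2[of "{UNIV}"]) (auto simp: eq)
  qed
  then show ?thesis
    using pos[of UNIV] by (simp add: cm_norm_def emeasure_to_measure[OF \<sigma>])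
qed

lemma abs_integral_to_measure_le:
  fixes f :: "'a::t2_space \<Rightarrow> real"
  assumes \<sigma>: "\<sigma> \<in> positive_cone" and f: "continuous_on UNIV f" and B: "\<And>x. \<bar>f x\<bar> \<le> B"
  shows "\<bar>integral\<^sup>L (to_measure \<sigma>) f\<bar> \<le> B * Re (\<sigma> UNIV)"
proof -
  have pos: "0 \<le> Re (\<sigma> UNIV)" using \<sigma> by (auto simp: positive_cone_def)
  interpret finite_measure "to_measure \<sigma>"
    by standard (simp add: emeasure_to_measure[OF \<sigma>])
  have [measurable]: "f \<in> borel_measurable (to_measure \<sigma>)"
    using borel_measurable_continuous_onI[OF f] by simp
  have "integrable (to_measure \<sigma>) f"
    by (rule integrable_const_bound[of _ B]) (use B in auto)
  then have "\<bar>integral\<^sup>L (to_measure \<sigma>) f\<bar> \<le> (\<integral>x. B \<partial>to_measure \<sigma>)"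
    by (intro order.trans[OF integral_abs_bound] integral_mono) (use B in auto)
  also have "\<dots> = B * Re (\<sigma> UNIV)"
    using pos by (simp add: measure_def emeasure_to_measure[OF \<sigma>])
  finally show ?thesis .
qed

lemma topspace_weak_topology: "topspace weak_topology = positive_cone"
  by (auto simp: weak_topology_def topspace_pullback_topology)

text \<open>On a compact space every continuous test function is bounded, so its integrals vanish
  along with the masses.\<close>

lemma limitin_weak_topology_zero:
  fixes \<sigma> :: "nat \<Rightarrow> 'a::t2_space cmeas"
  assumes "compact (UNIV :: 'a set)" and \<sigma>: "\<And>n. \<sigma> n \<in> positive_cone"
    and mass: "(\<lambda>n. Re (\<sigma> n UNIV)) \<longlonglongrightarrow> 0"
  shows "limitin weak_topology \<sigma> (\<lambda>_. 0) sequentially"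
proof -
  let ?C = "{f :: 'a \<Rightarrow> real. continuous_on UNIV f}"
  let ?J = "\<lambda>\<mu> :: 'a cmeas. \<lambda>f\<in>?C. integral\<^sup>L (to_measure \<mu>) f"
  have lim: "(\<lambda>n. integral\<^sup>L (to_measure (\<sigma> n)) f) \<longlonglongrightarrow> integral\<^sup>L (to_measure (\<lambda>_. 0)) f"
    if f: "continuous_on UNIV f" for f :: "'a \<Rightarrow> real"
  proof -
    have "bounded (range f)"
      using compact_continuous_image[OF f assms(1)] by (rule compact_imp_bounded)
    then obtain B where B: "\<And>x. \<bar>f x\<bar> \<le> B" by (auto simp: bounded_iff)
    have "integral\<^sup>L (to_measure (\<lambda>_. 0)) f = 0"
      using abs_integral_to_measure_le[OF zero_in_positive_cone f B] by simp
    moreover have "(\<lambda>n. integral\<^sup>L (to_measure (\<sigma> n)) f) \<longlonglongrightarrow> 0"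
    proof (rule Lim_null_comparison)
      show "\<forall>\<^sub>F n in sequentially. norm (integral\<^sup>L (to_measure (\<sigma> n)) f) \<le> B * Re (\<sigma> n UNIV)"
        using abs_integral_to_measure_le[OF \<sigma> f B] by simp
      show "(\<lambda>n. B * Re (\<sigma> n UNIV)) \<longlonglongrightarrow> 0"
        using tendsto_mult_right_zero[OF mass] by simp
    qed
    ultimately show ?thesis by simp
  qed
  have "limitin (product_topology (\<lambda>_. euclideanreal) ?C) (?J \<circ> \<sigma>) (?J (\<lambda>_. 0)) sequentially"
    using lim by (auto simp: limitin_componentwise)
  then show ?thesis
    unfolding weak_topology_def limitin_def topspace_pullback_topology openin_pullback_topology
    using \<sigma> zero_in_positive_cone by (auto elim!: eventually_mono)

qed

text \<open>Integration against \<delta>_x is evaluation at x, so each coordinate of the initial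
  topology pulls back to the test function itself. Through this map the weak continuity of a
  representation becomes continuity of its matrix entries on K.\<close>

lemma continuous_map_dirac: "continuous_map euclidean weak_topology (dirac :: 'a::t2_space \<Rightarrow> _)"
proof -
  have "integral\<^sup>L (to_measure (dirac x)) f = f x" if f: "continuous_on UNIV f" for x :: 'a and f :: "'a \<Rightarrow> real"
  proof -
    have "to_measure (dirac x) = return borel x"
      by (rule measure_eqI) (auto simp: emeasure_to_measure[OF dirac_in_positive_cone] dirac_apply)
    then show ?thesis
      using borel_measurable_continuous_onI[OF f] by (simp add: integral_return)
  qed
  then show ?thesis
    unfolding weak_topology_def
    by (intro continuous_map_pullback')
      (auto simp: continuous_map_componentwise dirac_in_positive_cone o_def)
qed

section \<open>Coordinates and norms in ell^2\<close>

lemma ell2_inner_unit_vec: "ell2_inner v (unit_vec j) = v j"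
proof -
  have "(\<lambda>n. v n * cnj (unit_vec j n)) = (\<lambda>n. if n = j then v n else 0)"
    by (auto simp: unit_vec_def)
  then show ?thesis
    unfolding ell2_inner_def using sums_single[of j v] by (simp add: sums_iff)
qed

lemma ell2_inner_self: "v \<in> ell2 I \<Longrightarrow> ell2_inner v v = complex_of_real (\<Sum>n. (cmod (v n))\<^sup>2)"
  unfolding ell2_inner_def ell2_def
  by (simp add: suminf_of_real complex_norm_square[symmetric] del: of_real_power)

lemma unit_vec_in_ell2: "j \<in> I \<Longrightarrow> unit_vec j \<in> ell2 I"
  unfolding ell2_def unit_vec_def
  by (auto intro!: summable_finite[of "{j}"] split: if_splits)

section \<open>Contractivity of representations\<close>

context compact_hypergroup
begin

lemma chk_chk [simp]: "chk (chk x) = x"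
  using chk_homeomorphism by (simp add: homeomorphism_def)

text \<open>Because measures are 0 on non-Borel sets by convention, equality requires
  \<open>chk\<close> to preserve Borel sets in both directions.\<close>

lemma cm_check_dirac: "cm_check chk (dirac x) = dirac (chk x)"
proof
  fix E :: "'a set"
  have image_eq: "chk ` E = chk -` E" for E by (force simp: image_iff)
  have [measurable]: "chk \<in> borel_measurable borel"
    using chk_homeomorphism by (intro borel_measurable_continuous_onI) (simp add: homeomorphism_def)
  have borel: "chk ` E \<in> sets borel" if "E \<in> sets borel" for E
    using measurable_sets[of chk borel borel E] that by (simp add: image_eq)
  have "chk ` chk ` E = E" by (simp add: image_image)
  with borel[of E] borel[of "chk ` E"] have "chk ` E \<in> sets borel \<longleftrightarrow> E \<in> sets borel"
    by metis
  moreover have "x \<in> chk ` E \<longleftrightarrow> chk x \<in> E"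
    unfolding image_eq by simp
  ultimately show "cm_check chk (dirac x) E = dirac (chk x) E"
    by (simp add: cm_check_def dirac_apply)
qed

text \<open>The values are real, so conjugation does nothing. This connects
  \<open>chk_involution\<close>, an axiom on \<open>cm_check\<close>, with the adjoint in
  \<open>representation\<close>, which is taken through \<open>cm_star\<close>.\<close>

lemma cm_star_positive_cone:
  assumes "\<sigma> \<in> positive_cone"
  shows "cm_star chk \<sigma> = cm_check chk \<sigma>"
  using assms by (auto simp: cm_star_def cm_check_def positive_cone_def complex_is_Real_iff complex_eq_iff fun_eq_iff)

text \<open>Positivity is hidden in the weak continuity axiom: a continuous map sends topspace to
  topspace, and the topspace of the weak topology is the positive cone.\<close>

lemma conv_positive_cone:
  assumes "\<sigma> \<in> positive_cone" "\<tau> \<in> positive_cone"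
  shows "conv \<sigma> \<tau> \<in> positive_cone"
  using continuous_map_image_subset_topspace[OF conv_weakly_continuous] assms
  by (auto simp: topspace_weak_topology)

lemma conv_mass_le:
  assumes "\<sigma> \<in> positive_cone" "\<tau> \<in> positive_cone"
  shows "Re (conv \<sigma> \<tau> UNIV) \<le> Re (\<sigma> UNIV) * Re (\<tau> UNIV)"
  using conv_norm[of \<sigma> \<tau>] assms positive_cone_subset
  by (auto simp: cm_norm_positive_cone conv_positive_cone)

text \<open>The n-th measure is sent by a representation \<pi> to the power 2^n of \<pi>(x)*
  \<pi>(x).\<close>

definition conv_square_iter :: "'a \<Rightarrow> nat \<Rightarrow> 'a cmeas" where
  "conv_square_iter x n = ((\<lambda>\<sigma>. conv \<sigma> \<sigma>) ^^ n) (conv (dirac (chk x)) (dirac x))"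

text \<open>The check map reverses factors, so \<delta>_(chk x) * \<delta>_x is fixed by it, and
  squaring preserves this. The masses stay below 1 however fast the operators might grow; this
  contrast drives the contraction argument.\<close>

lemma conv_square_iter:
  "conv_square_iter x n \<in> positive_cone \<and> Re (conv_square_iter x n UNIV) \<le> 1 \<and>
   cm_star chk (conv_square_iter x n) = conv_square_iter x n"
proof (induction n)
  case 0
  have "cm_check chk (conv (dirac (chk x)) (dirac x)) = conv (dirac (chk x)) (dirac x)"
    using dirac_in_positive_cone positive_cone_subset
    by (subst chk_involution) (auto simp: cm_check_dirac)
  then show ?case
    using conv_dirac_prob[of "chk x" x] by (simp add: conv_square_iter_def cm_star_positive_cone)
next
  case (Suc n)
  let ?\<rho> = "conv_square_iter x n"
  have *: "?\<rho> \<in> positive_cone" "Re (?\<rho> UNIV) \<le> 1" "cm_check chk ?\<rho> = ?\<rho>"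
    using Suc by (auto simp: cm_star_positive_cone)
  have "0 \<le> Re (?\<rho> UNIV)" using *(1) by (auto simp: positive_cone_def)
  then have "Re (conv ?\<rho> ?\<rho> UNIV) \<le> 1"
    using conv_mass_le[OF *(1) *(1)] mult_le_one[of "Re (?\<rho> UNIV)" "Re (?\<rho> UNIV)"] *(2) by simp
  moreover have "cm_check chk (conv ?\<rho> ?\<rho>) = conv ?\<rho> ?\<rho>"
    using * positive_cone_subset by (subst chk_involution) auto
  ultimately show ?case
    using conv_positive_cone[OF *(1) *(1)] by (simp add: conv_square_iter_def cm_star_positive_cone)
qed

text \<open>With $\rho_0 = \delta_{\check x} * \delta_x$, $\rho_{n+1} = \rho_n * \rho_n$ and
  $b_n = \langle \pi(\rho_n) e_j, e_j\rangle$ one has $b_0 = \|\pi(x) e_j\|^2$ and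
  $b_n^2 \le \|\pi(\rho_n) e_j\|^2 = b_{n+1}$. If $b_0 > 1$ then $b_n \to \infty$, so the positive measures
  $b_n^{-1} \delta_e * \rho_n$ tend weakly to $0$ although $\pi$ maps them to operators with
  diagonal entry $1$.\<close>

lemma representation_contraction:
  assumes rep: "representation conv chk e (I, \<pi>)" and j: "j \<in> I"
  shows "\<pi> (dirac x) (unit_vec j) \<in> ell2 I"
    and "(\<Sum>n. (cmod (\<pi> (dirac x) (unit_vec j) n))\<^sup>2) \<le> 1"
proof -
  let ?u = "unit_vec j" and ?\<rho> = "conv_square_iter x"
  have u: "?u \<in> ell2 I" by (rule unit_vec_in_ell2[OF j])
  note alg = subsetD[OF positive_cone_subset]
  have d: "dirac y \<in> measure_algebra" for y :: 'a by (rule alg[OF dirac_in_positive_cone])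
  have \<rho>: "?\<rho> n \<in> measure_algebra" for n using conv_square_iter[of x n] alg by blast
  have maps: "\<pi> \<sigma> v \<in> ell2 I" if "\<sigma> \<in> measure_algebra" "v \<in> ell2 I" for \<sigma> v
    using rep that by (simp add: representation_def bounded_operator_def linear_ell2_def image_subset_iff)
  have lin: "\<pi> (cm_lincomb a \<sigma> \<tau>) v = (\<lambda>n. a * \<pi> \<sigma> v n + \<pi> \<tau> v n)"
    if "\<sigma> \<in> measure_algebra" "\<tau> \<in> measure_algebra" "v \<in> ell2 I" for a \<sigma> \<tau> v
    using rep that by (simp add: representation_def)
  have mult: "\<pi> (conv \<sigma> \<tau>) v = \<pi> \<sigma> (\<pi> \<tau> v)"
    if "\<sigma> \<in> measure_algebra" "\<tau> \<in> measure_algebra" "v \<in> ell2 I" for \<sigma> \<tau> v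
    using rep that by (simp add: representation_def)
  have star: "ell2_inner (\<pi> (cm_star chk \<sigma>) v) v' = ell2_inner v (\<pi> \<sigma> v')"
    if "\<sigma> \<in> measure_algebra" "v \<in> ell2 I" "v' \<in> ell2 I" for \<sigma> v v'
    using rep that by (simp add: representation_def)
  have unit: "\<pi> (dirac e) v = v" if "v \<in> ell2 I" for v
    using rep that by (simp add: representation_def)
  have cont: "continuous_map weak_topology euclidean (\<lambda>\<sigma>. ell2_inner (\<pi> \<sigma> ?u) ?u)"
    using rep u by (simp add: representation_def)
  show w: "\<pi> (dirac x) ?u \<in> ell2 I" by (rule maps[OF d u])
  define b where "b n = Re (\<pi> (?\<rho> n) ?u j)" for n
  have b_0: "b 0 = (\<Sum>n. (cmod (\<pi> (dirac x) ?u n))\<^sup>2)"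
  proof -
    have "\<pi> (?\<rho> 0) ?u j = ell2_inner (\<pi> (cm_star chk (dirac x)) (\<pi> (dirac x) ?u)) ?u"
      using mult[OF d d u]
      by (simp add: conv_square_iter_def ell2_inner_unit_vec cm_star_positive_cone dirac_in_positive_cone cm_check_dirac)
    also have "\<dots> = ell2_inner (\<pi> (dirac x) ?u) (\<pi> (dirac x) ?u)"
      by (rule star[OF d w u])
    finally show ?thesis by (simp add: b_def ell2_inner_self[OF w])
  qed
  have b_Suc: "(b n)\<^sup>2 \<le> b (Suc n)" for n
  proof -
    let ?v = "\<pi> (?\<rho> n) ?u"
    have v: "?v \<in> ell2 I" by (rule maps[OF \<rho> u])
    have "\<pi> (?\<rho> (Suc n)) ?u j = ell2_inner (\<pi> (cm_star chk (?\<rho> n)) ?v) ?u"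
      using mult[OF \<rho> \<rho> u, of n n] conv_square_iter[of x n]
      by (simp add: conv_square_iter_def ell2_inner_unit_vec)
    also have "\<dots> = ell2_inner ?v ?v"
      by (rule star[OF \<rho> v u])
    finally have "b (Suc n) = (\<Sum>m. (cmod (?v m))\<^sup>2)"
      by (simp add: b_def ell2_inner_self[OF v])
    \<comment> \<open>Cauchy-Schwarz against e_j in coordinate form: v_j is the inner product of v
      with e_j.\<close>
    moreover have "(cmod (?v j))\<^sup>2 \<le> (\<Sum>m. (cmod (?v m))\<^sup>2)"
      using v sum_le_suminf[of "\<lambda>m. (cmod (?v m))\<^sup>2" "{j}"] by (simp add: ell2_def)
    moreover have "(b n)\<^sup>2 \<le> (cmod (?v j))\<^sup>2"
      unfolding b_def by (rule abs_le_square_iff[THEN iffD1]) (simp add: abs_Re_le_cmod)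
    ultimately show ?thesis by simp
  qed
  show "(\<Sum>n. (cmod (\<pi> (dirac x) ?u n))\<^sup>2) \<le> 1"
  proof (rule ccontr)
    assume "\<not> ?thesis"
    then have b1: "1 < b 0" by (simp add: b_0)
    \<comment> \<open>Squaring would even give b_0^(2^n), but a geometric lower bound suffices for
      1/b_n to tend to 0.\<close>
    have growth: "b 0 ^ Suc n \<le> b n" for n
    proof (induction n)
      case (Suc n)
      have "b 0 * 1 \<le> b 0 ^ Suc n" using b1 by simp
      then have "b 0 \<le> b n" using Suc by linarith
      then have "b 0 ^ Suc (Suc n) \<le> b n * b n"
        using mult_mono[OF Suc, of "b 0" "b n"] b1 by (simp add: mult_ac)
      then show ?case using b_Suc[of n] by (simp add: power2_eq_square)
    qed simp
    have b_pos: "0 < b n" for n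
      using growth[of n] zero_less_power[of "b 0" "Suc n"] b1 by linarith
    \<comment> \<open>Scaling is expressed as convolution with b_n^(-1) \<delta>_e: positivity and
      the mass bound then come from the convolution lemmas, with no separate regularity argument for
      multiples of a measure.\<close>
    define \<sigma> where "\<sigma> n = conv (point_mass (1 / b n) e) (?\<rho> n)" for n
    have pm: "point_mass (1 / b n) e \<in> positive_cone" for n
      using b_pos[of n] by (intro point_mass_in_positive_cone) simp
    have \<sigma>: "\<sigma> n \<in> positive_cone" for n
      unfolding \<sigma>_def using conv_positive_cone[OF pm] conv_square_iter by blast
    have "Re (\<sigma> n UNIV) \<le> (1 / b 0) ^ Suc n" for n
    proof -
      have "Re (\<sigma> n UNIV) \<le> (1 / b n) * Re (?\<rho> n UNIV)"
        unfolding \<sigma>_def using conv_mass_le[OF pm] conv_square_iter by (simp add: point_mass_apply)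
      also have "\<dots> \<le> 1 / b n"
        using conv_square_iter[of x n] b_pos[of n] by (simp add: divide_right_mono)
      also have "\<dots> \<le> 1 / b 0 ^ Suc n"
        using growth[of n] b1 by (intro divide_left_mono) (auto intro!: mult_pos_pos b_pos)
      finally show ?thesis by (simp add: power_divide)
    qed
    moreover have "(\<lambda>n. (1 / b 0) ^ Suc n) \<longlonglongrightarrow> 0"
      using b1 LIMSEQ_power_zero[of "1 / b 0"] by (intro LIMSEQ_Suc) simp
    moreover have "0 \<le> Re (\<sigma> n UNIV)" for n using \<sigma>[of n] by (simp add: positive_cone_def)
    ultimately have "(\<lambda>n. Re (\<sigma> n UNIV)) \<longlonglongrightarrow> 0"
      by (intro Lim_null_comparison[of "\<lambda>n. Re (\<sigma> n UNIV)"]) auto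
    from continuous_map_limit[OF cont limitin_weak_topology_zero[OF compact_UNIV \<sigma> this]]
    have lim: "(\<lambda>n. \<pi> (\<sigma> n) ?u j) \<longlonglongrightarrow> \<pi> (\<lambda>_. 0) ?u j"
      by (simp add: o_def ell2_inner_unit_vec)
    have z: "(\<lambda>_. 0) \<in> (measure_algebra :: 'a cmeas set)"
      by (rule alg[OF zero_in_positive_cone])
    \<comment> \<open>The zero measure is 1 times itself plus itself, so \<pi>(0) v = 2 \<pi>(0)
      v.\<close>
    have zero: "\<pi> (\<lambda>_. 0) v n = 0" if "v \<in> ell2 I" for v n
      using fun_cong[OF lin[OF z z that, of 1], of n] by (simp add: cm_lincomb_def)
    have "\<pi> (\<sigma> n) ?u j = complex_of_real (1 / b n) * \<pi> (?\<rho> n) ?u j" for n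
      using maps[OF \<rho> u, of n] z d alg[OF pm, of n] \<rho>[of n] u
      by (simp add: \<sigma>_def mult point_mass_def lin unit zero)
    then have "Re (\<pi> (\<sigma> n) ?u j) = 1" for n
      using b_pos[of n] by (simp add: b_def Re_divide_of_real)
    then show False
      using tendsto_Re[OF lim] zero[OF u] by (simp add: LIMSEQ_const_iff)
  qed
qed

text \<open>A class is the set of irreducibles equivalent to some \<rho>. Reflexivity, witnessed by
  the identity, puts \<rho> into it, so the choice operator picks a genuine member.\<close>

lemma dual_rep_in_irreps:
  assumes "c \<in> dual conv chk e"
  shows "dual_rep c \<in> irreps conv chk e"
proof -
  obtain \<rho> where \<rho>: "\<rho> \<in> irreps conv chk e"
    and c: "c = {\<sigma>. \<sigma> \<in> irreps conv chk e \<and> unitarily_equivalent \<rho> \<sigma>}"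
    using assms unfolding dual_def by (elim quotientE) auto
  have "unitarily_equivalent \<rho> \<rho>"
    unfolding unitarily_equivalent_def split_beta by (rule exI[of _ id]) (simp add: linear_ell2_def)
  then have "\<rho> \<in> c" using \<rho> c by simp
  then have "dual_rep c \<in> c" unfolding dual_rep_def by (rule someI)
  then show ?thesis using c by simp
qed

lemma dual_rep_representation:
  assumes "c \<in> dual conv chk e"
  shows "representation conv chk e (dual_index c, snd (dual_rep c))" "dual_index c \<noteq> {}"
  using dual_rep_in_irreps[OF assms]
  by (auto simp: irreps_def dual_index_def irreducible_rep_def split: prod.splits)

lemma continuous_on_dual_entry:
  assumes c: "c \<in> dual conv chk e" and "i \<in> dual_index c" "j \<in> dual_index c"
  shows "continuous_on UNIV (dual_entry c i j)"
proof -
  have "continuous_map weak_topology euclidean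
      (\<lambda>\<sigma>. ell2_inner (snd (dual_rep c) \<sigma> (unit_vec j)) (unit_vec i))"
    using dual_rep_representation(1)[OF c] assms(2,3)[THEN unit_vec_in_ell2]
    by (simp add: representation_def)
  from continuous_map_compose[OF continuous_map_dirac this] show ?thesis
    by (simp add: o_def dual_entry_def[abs_def])
qed

text \<open>Column j of the matrix is the vector \<pi>(x) e_j. The set F is an arbitrary finite one
  because finiteness of \<open>dual_index c\<close> is itself deduced from this bound.\<close>

lemma sum_dual_entry_le_1:
  assumes c: "c \<in> dual conv chk e" and j: "j \<in> dual_index c" and F: "finite F"
  shows "(\<Sum>i\<in>F. (cmod (dual_entry c i j x))\<^sup>2) \<le> 1"
proof -
  note contr = representation_contraction[OF dual_rep_representation(1)[OF c] j, of x]
  have "(\<Sum>i\<in>F. (cmod (dual_entry c i j x))\<^sup>2) \<le> (\<Sum>n. (cmod (snd (dual_rep c) (dirac x) (unit_vec j) n))\<^sup>2)"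
    unfolding dual_entry_def ell2_inner_unit_vec using contr(1) F
    by (intro sum_le_suminf) (auto simp: ell2_def)
  also note contr(2)
  finally show ?thesis .
qed

end

section \<open>Fourier coefficients\<close>

lemma borel_measurable_cnj [measurable (raw)]:
  "f \<in> borel_measurable M \<Longrightarrow> (\<lambda>x. cnj (f x)) \<in> borel_measurable M"
  by (intro borel_measurable_continuous_on[where f = cnj] continuous_intros)

lemma integrable_mult_cnj:
  fixes f g :: "'a \<Rightarrow> complex"
  assumes [measurable]: "f \<in> borel_measurable M" "g \<in> borel_measurable M"
    and "integrable M (\<lambda>x. (cmod (f x))\<^sup>2)" "integrable M (\<lambda>x. (cmod (g x))\<^sup>2)"
  shows "integrable M (\<lambda>x. f x * cnj (g x))"
proof (rule Bochner_Integration.integrable_bound)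
  show "integrable M (\<lambda>x. (cmod (f x))\<^sup>2 + (cmod (g x))\<^sup>2)" using assms by simp
  have "a * b \<le> a\<^sup>2 + b\<^sup>2" if "0 \<le> a" "0 \<le> b" for a b :: real
    using sum_squares_bound[of a b] mult_nonneg_nonneg[OF that] by linarith
  then show "AE x in M. norm (f x * cnj (g x)) \<le> norm ((cmod (f x))\<^sup>2 + (cmod (g x))\<^sup>2)"
    by (auto simp: norm_mult intro!: AE_I2)
qed measurable

text \<open>Testing $f$ against its orthogonal projection $g$ gives
  $\langle f, g\rangle = \|g\|_2^2 =$ the left-hand side.\<close>

lemma bessel_inequality:
  fixes f :: "'a \<Rightarrow> complex" and \<phi> :: "'s \<Rightarrow> 'a \<Rightarrow> complex"
  assumes "finite S" and [measurable]: "f \<in> borel_measurable M" "\<And>s. s \<in> S \<Longrightarrow> \<phi> s \<in> borel_measurable M"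
    and f2: "integrable M (\<lambda>x. (cmod (f x))\<^sup>2)"
    and \<phi>2: "\<And>s. s \<in> S \<Longrightarrow> integrable M (\<lambda>x. (cmod (\<phi> s x))\<^sup>2)"
    and n: "\<And>s. s \<in> S \<Longrightarrow> 0 < n s"
    and orth: "\<And>s t. s \<in> S \<Longrightarrow> t \<in> S \<Longrightarrow>
      (\<integral>x. \<phi> s x * cnj (\<phi> t x) \<partial>M) = (if s = t then complex_of_real (n s) else 0)"
  shows "(\<Sum>s\<in>S. (cmod (\<integral>x. f x * cnj (\<phi> s x) \<partial>M))\<^sup>2 / n s) \<le> (\<integral>x. (cmod (f x))\<^sup>2 \<partial>M)"
proof -
  define a where "a s = (\<integral>x. f x * cnj (\<phi> s x) \<partial>M)" for s
  define E where "E = (\<Sum>s\<in>S. (cmod (a s))\<^sup>2 / n s)"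
  \<comment> \<open>Since \<open>n s\<close> is the squared norm of \<open>\<phi> s\<close>, these
    are the projection coefficients.\<close>
  define g where "g x = (\<Sum>s\<in>S. a s / n s * \<phi> s x)" for x
  have [measurable]: "g \<in> borel_measurable M" unfolding g_def by measurable
  have f\<phi>: "integrable M (\<lambda>x. f x * cnj (\<phi> s x))" if "s \<in> S" for s
    using f2 \<phi>2 that by (intro integrable_mult_cnj) auto
  have \<phi>\<phi>: "integrable M (\<lambda>x. \<phi> s x * cnj (\<phi> t x))" if "s \<in> S" "t \<in> S" for s t
    using \<phi>2 that by (intro integrable_mult_cnj) auto
  have sq: "a s * cnj (a s) / n s = complex_of_real ((cmod (a s))\<^sup>2 / n s)" for s
    using complex_norm_square[of "a s"] by simp
  have E_eq: "complex_of_real E = (\<Sum>s\<in>S. a s * cnj (a s) / n s)"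
    by (simp only: E_def of_real_sum sq)
  have "(\<integral>x. f x * cnj (g x) \<partial>M) = (\<integral>x. (\<Sum>s\<in>S. cnj (a s) / n s * (f x * cnj (\<phi> s x))) \<partial>M)"
    by (simp add: g_def sum_distrib_left mult_ac)
  also have "\<dots> = (\<Sum>s\<in>S. cnj (a s) / n s * a s)"
    unfolding a_def by (subst Bochner_Integration.integral_sum) (auto simp: f\<phi>)
  also have "\<dots> = complex_of_real E" by (simp add: E_eq mult.commute)
  finally have fg: "(\<integral>x. f x * cnj (g x) \<partial>M) = complex_of_real E" .
  have g_int: "integrable M (\<lambda>x. g x * cnj (g x))"
    and gg: "(\<integral>x. g x * cnj (g x) \<partial>M) = complex_of_real E"
  proof -
    have eq: "g x * cnj (g x) = (\<Sum>s\<in>S. \<Sum>t\<in>S. a s / n s * cnj (a t / n t) * (\<phi> s x * cnj (\<phi> t x)))" for x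
      by (simp add: g_def sum_product mult_ac)
    show "integrable M (\<lambda>x. g x * cnj (g x))"
      unfolding eq by (intro Bochner_Integration.integrable_sum integrable_mult_right \<phi>\<phi>)
    have "(\<integral>x. g x * cnj (g x) \<partial>M)
        = (\<Sum>s\<in>S. \<Sum>t\<in>S. a s / n s * cnj (a t / n t) * (\<integral>x. \<phi> s x * cnj (\<phi> t x) \<partial>M))"
      unfolding eq
      by (simp add: Bochner_Integration.integral_sum Bochner_Integration.integrable_sum \<phi>\<phi>)
    also have "\<dots> = (\<Sum>s\<in>S. \<Sum>t\<in>S. if s = t then a s / n s * cnj (a t / n t) * n s else 0)"
      by (intro sum.cong refl) (simp add: orth)
    also have "\<dots> = (\<Sum>s\<in>S. a s / n s * cnj (a s / n s) * n s)"
      using \<open>finite S\<close> by simp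
    also have "\<dots> = (\<Sum>s\<in>S. a s * cnj (a s) / n s)"
      using n by (intro sum.cong refl) force
    finally show "(\<integral>x. g x * cnj (g x) \<partial>M) = complex_of_real E" by (simp only: E_eq)
  qed
  have g_sq: "g x * cnj (g x) = complex_of_real ((cmod (g x))\<^sup>2)" for x
    using complex_norm_square[of "g x"] by simp
  have g2: "integrable M (\<lambda>x. (cmod (g x))\<^sup>2)" and "(\<integral>x. (cmod (g x))\<^sup>2 \<partial>M) = E"
    using g_int gg unfolding g_sq integral_complex_of_real complex_of_real_integrable_eq by (auto simp del: of_real_power)
  \<comment> \<open>Here 2|f g| \<le> |f|^2 + |g|^2 replaces Cauchy-Schwarz: as g has squared norm
    E, it gives E \<le> (||f||^2 + E)/2, and E/2 is absorbed.\<close>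
  have "E \<le> cmod (\<integral>x. f x * cnj (g x) \<partial>M)" by (simp add: fg)
  also have "\<dots> \<le> (\<integral>x. ((cmod (f x))\<^sup>2 + (cmod (g x))\<^sup>2) / 2 \<partial>M)"
  proof (rule order.trans[OF integral_norm_bound integral_mono])
    show "integrable M (\<lambda>x. norm (f x * cnj (g x)))"
      using f2 g2 by (intro integrable_norm integrable_mult_cnj) auto
    show "integrable M (\<lambda>x. ((cmod (f x))\<^sup>2 + (cmod (g x))\<^sup>2) / 2)" using f2 g2 by auto
    show "norm (f x * cnj (g x)) \<le> ((cmod (f x))\<^sup>2 + (cmod (g x))\<^sup>2) / 2" for x
      using sum_squares_bound[of "cmod (f x)" "cmod (g x)"] by (simp add: norm_mult)
  qed
  also have "\<dots> = ((\<integral>x. (cmod (f x))\<^sup>2 \<partial>M) + E) / 2"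
    using f2 g2 \<open>(\<integral>x. (cmod (g x))\<^sup>2 \<partial>M) = E\<close> by simp
  finally show ?thesis by (simp add: E_def a_def)
qed

text \<open>Minkowski's integral inequality by duality: the coefficient vector a is tested against
  itself, the pointwise Cauchy-Schwarz inequality yields ||a||^2 \<le> R ||a|| ||f||_1, and ||a|| is
  cancelled. The constant does not depend on the size of S.\<close>

lemma L2_set_integral_le:
  fixes f :: "'a \<Rightarrow> complex" and \<phi> :: "'s \<Rightarrow> 'a \<Rightarrow> complex"
  assumes f: "integrable M f" and [measurable]: "\<And>s. s \<in> S \<Longrightarrow> \<phi> s \<in> borel_measurable M"
    and R: "\<And>x. L2_set (\<lambda>s. cmod (\<phi> s x)) S \<le> R" and "finite S"
  shows "L2_set (\<lambda>s. cmod (\<integral>x. f x * cnj (\<phi> s x) \<partial>M)) S \<le> R * (\<integral>x. cmod (f x) \<partial>M)"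
proof -
  have [measurable]: "f \<in> borel_measurable M" using f by simp
  define a where "a s = (\<integral>x. f x * cnj (\<phi> s x) \<partial>M)" for s
  let ?L = "L2_set (\<lambda>s. cmod (a s)) S"
  have L: "0 \<le> ?L" by simp
  have int: "integrable M (\<lambda>x. f x * cnj (\<phi> s x))" if s: "s \<in> S" for s
  proof (rule Bochner_Integration.integrable_bound)
    show "integrable M (\<lambda>x. R * cmod (f x))" using f by simp
    have le: "cmod (\<phi> s x) \<le> R" for x
      using member_le_L2_set[OF \<open>finite S\<close> s, of "\<lambda>s. cmod (\<phi> s x)"] R[of x] by linarith
    have "cmod (f x * cnj (\<phi> s x)) \<le> R * cmod (f x)" for x
      using mult_left_mono[OF le[of x] norm_ge_zero[of "f x"]] by (simp add: norm_mult mult.commute)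
    then show "AE x in M. norm (f x * cnj (\<phi> s x)) \<le> norm (R * cmod (f x))"
      by (intro AE_I2) (auto intro: order.trans[OF _ abs_ge_self])
  qed (use s in measurable)
  have "complex_of_real (?L\<^sup>2) = (\<Sum>s\<in>S. a s * cnj (a s))"
    by (simp add: L2_set_def sum_nonneg complex_norm_square del: of_real_power)
  also have "\<dots> = (\<integral>x. (\<Sum>s\<in>S. f x * cnj (\<phi> s x) * cnj (a s)) \<partial>M)"
    using int by (subst Bochner_Integration.integral_sum) (auto simp: a_def)
  also have "cmod \<dots> \<le> (\<integral>x. R * ?L * cmod (f x) \<partial>M)"
  proof (rule order.trans[OF integral_norm_bound integral_mono])
    show "integrable M (\<lambda>x. norm (\<Sum>s\<in>S. f x * cnj (\<phi> s x) * cnj (a s)))"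
      using int by (intro integrable_norm) auto
    show "integrable M (\<lambda>x. R * ?L * cmod (f x))" using f by simp
    fix x
    have "norm (\<Sum>s\<in>S. f x * cnj (\<phi> s x) * cnj (a s)) \<le> (\<Sum>s\<in>S. cmod (f x) * (\<bar>cmod (\<phi> s x)\<bar> * \<bar>cmod (a s)\<bar>))"
      by (intro sum_norm_le) (simp add: norm_mult mult_ac)
    also have "\<dots> \<le> cmod (f x) * (L2_set (\<lambda>s. cmod (\<phi> s x)) S * ?L)"
      unfolding sum_distrib_left[symmetric] by (intro mult_left_mono L2_set_mult_ineq) auto
    also have "\<dots> \<le> cmod (f x) * (R * ?L)"
      using R L by (intro mult_left_mono mult_right_mono) auto
    finally show "norm (\<Sum>s\<in>S. f x * cnj (\<phi> s x) * cnj (a s)) \<le> R * ?L * cmod (f x)"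
      by (simp add: mult_ac)
  qed
  finally have "?L * ?L \<le> (R * (\<integral>x. cmod (f x) \<partial>M)) * ?L"
    using L by (simp add: norm_mult power2_eq_square mult_ac)
  moreover have "0 \<le> R" using R[of undefined] L2_set_nonneg order.trans by blast
  ultimately have "?L \<le> R * (\<integral>x. cmod (f x) \<partial>M)"
    using L by (cases "?L = 0") auto
  then show ?thesis by (simp add: a_def)
qed

lemma hs_norm_eq_L2_set: "hs_norm I A = L2_set (\<lambda>s. cmod (A (fst s) (snd s))) (I \<times> I)"
  by (simp add: hs_norm_def L2_set_def sum.cartesian_product split_beta)

lemma hs_norm_nonneg: "0 \<le> hs_norm I A"
  by (simp add: hs_norm_eq_L2_set)

lemma hs_norm_triangle: "hs_norm I (\<lambda>i j. A i j + B i j) \<le> hs_norm I A + hs_norm I B"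
proof -
  have "hs_norm I (\<lambda>i j. A i j + B i j) \<le> L2_set (\<lambda>s. cmod (A (fst s) (snd s)) + cmod (B (fst s) (snd s))) (I \<times> I)"
    unfolding hs_norm_eq_L2_set by (intro L2_set_mono) (auto intro: norm_triangle_ineq)
  also have "\<dots> \<le> hs_norm I A + hs_norm I B"
    unfolding hs_norm_eq_L2_set by (rule L2_set_triangle_ineq)
  finally show ?thesis .
qed

section \<open>Finite dimension and the two endpoint bounds for the Fourier transform\<close>

locale hypergroup_fourier = compact_hypergroup conv chk e + prob_space \<Lambda>
  for conv :: "'a::t2_space cmeas \<Rightarrow> 'a cmeas \<Rightarrow> 'a cmeas" and chk e and \<Lambda> :: "'a measure" +
  fixes k :: "'a rep set \<Rightarrow> real"
  assumes sets_\<Lambda> [simp, measurable_cong]: "sets \<Lambda> = sets borel"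
    and hyper: "hyperdimension \<Lambda> (dual conv chk e) k"
begin

lemma k_pos: "c \<in> dual conv chk e \<Longrightarrow> 0 < k c"
  using hyper by (auto simp: hyperdimension_def)

lemma dual_entry_measurable:
  "c \<in> dual conv chk e \<Longrightarrow> i \<in> dual_index c \<Longrightarrow> j \<in> dual_index c \<Longrightarrow> dual_entry c i j \<in> borel_measurable \<Lambda>"
  using borel_measurable_continuous_onI[OF continuous_on_dual_entry] by simp

lemma dual_entry_le_1:
  assumes "c \<in> dual conv chk e" "j \<in> dual_index c"
  shows "cmod (dual_entry c i j x) \<le> 1"
  using sum_dual_entry_le_1[OF assms, of "{i}" x] by (simp add: abs_square_le_1)

lemma integrable_dual_entry_sq:
  assumes "c \<in> dual conv chk e" "i \<in> dual_index c" "j \<in> dual_index c"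
  shows "integrable \<Lambda> (\<lambda>x. (cmod (dual_entry c i j x))\<^sup>2)"
  using dual_entry_measurable[OF assms] dual_entry_le_1[OF assms(1,3)]
  by (intro integrable_const_bound[of _ 1]) (auto simp: abs_square_le_1)

lemma integral_dual_entry_sq:
  assumes "c \<in> dual conv chk e" "i \<in> dual_index c" "j \<in> dual_index c"
  shows "(\<integral>x. (cmod (dual_entry c i j x))\<^sup>2 \<partial>\<Lambda>) = 1 / k c"
proof -
  have "(\<integral>x. dual_entry c i j x * cnj (dual_entry c i j x) \<partial>\<Lambda>) = complex_of_real (1 / k c)"
    using hyper assms by (auto simp: hyperdimension_def)
  then have "complex_of_real (\<integral>x. (cmod (dual_entry c i j x))\<^sup>2 \<partial>\<Lambda>) = complex_of_real (1 / k c)"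
    unfolding complex_norm_square[symmetric] of_real_power[symmetric] integral_complex_of_real .
  then show ?thesis by (simp only: of_real_eq_iff)
qed

lemma card_subset_dual_index_le:
  assumes c: "c \<in> dual conv chk e" and F: "finite F" "F \<subseteq> dual_index c"
  shows "card F \<le> k c"
proof -
  obtain j where j: "j \<in> dual_index c" using dual_rep_representation(2)[OF c] by blast
  have "card F / k c = (\<integral>x. (\<Sum>i\<in>F. (cmod (dual_entry c i j x))\<^sup>2) \<partial>\<Lambda>)"
    using F j c by (subst Bochner_Integration.integral_sum)
      (auto simp: integral_dual_entry_sq subset_iff intro!: integrable_dual_entry_sq)
  also have "\<dots> \<le> (\<integral>x. 1 \<partial>\<Lambda>)"
    using sum_dual_entry_le_1[OF c j F(1)] F j c
    by (intro integral_mono) (auto intro!: integrable_dual_entry_sq)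
  finally show ?thesis using k_pos[OF c] by (simp add: prob_space field_simps)
qed

text \<open>Makes \<open>hs_norm (dual_index c)\<close> a genuine norm: over an infinite index set
  its sums would be 0 by convention.\<close>

lemma finite_dual_index:
  assumes c: "c \<in> dual conv chk e"
  shows "finite (dual_index c)"
proof (rule ccontr)
  assume "infinite (dual_index c)"
  then obtain F where F: "F \<subseteq> dual_index c" "finite F" "card F = Suc (nat \<lceil>k c\<rceil>)"
    using infinite_arbitrarily_large by blast
  show False using card_subset_dual_index_le[OF c F(2,1)] F(3) by linarith
qed

text \<open>Contractivity controls columns, hence the exchange of sums: d columns of squared norm at
  most 1 give the pointwise bound d \<le> k on the squared HS norm of \<pi>(x).\<close>

lemma hs_norm_fourier_le:
  assumes c: "c \<in> dual conv chk e" and f: "integrable \<Lambda> f"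
  shows "hs_norm (dual_index c) (fourier \<Lambda> f c) \<le> sqrt (k c) * (\<integral>x. cmod (f x) \<partial>\<Lambda>)"
proof -
  let ?I = "dual_index c"
  let ?\<phi> = "\<lambda>s. dual_entry c (fst s) (snd s)"
  have "(\<Sum>s\<in>?I \<times> ?I. (cmod (?\<phi> s x))\<^sup>2) \<le> k c" for x
  proof -
    have "(\<Sum>s\<in>?I \<times> ?I. (cmod (?\<phi> s x))\<^sup>2) = (\<Sum>i\<in>?I. \<Sum>j\<in>?I. (cmod (dual_entry c i j x))\<^sup>2)"
      by (simp add: sum.cartesian_product split_beta)
    also have "\<dots> = (\<Sum>j\<in>?I. \<Sum>i\<in>?I. (cmod (dual_entry c i j x))\<^sup>2)"
      by (rule sum.swap)
    also have "\<dots> \<le> (\<Sum>j\<in>?I. 1)"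
      using finite_dual_index[OF c] by (intro sum_mono sum_dual_entry_le_1[OF c])
    also have "\<dots> \<le> k c"
      using card_subset_dual_index_le[OF c finite_dual_index[OF c]] by simp
    finally show ?thesis .
  qed
  then have "L2_set (\<lambda>s. cmod (?\<phi> s x)) (?I \<times> ?I) \<le> sqrt (k c)" for x
    by (simp add: L2_set_def)
  then have "L2_set (\<lambda>s. cmod (\<integral>x. f x * cnj (?\<phi> s x) \<partial>\<Lambda>)) (?I \<times> ?I) \<le> sqrt (k c) * (\<integral>x. cmod (f x) \<partial>\<Lambda>)"
    using finite_dual_index[OF c]
    by (intro L2_set_integral_le[OF f]) (auto intro!: dual_entry_measurable[OF c])
  then show ?thesis by (simp add: hs_norm_eq_L2_set fourier_def)
qed

text \<open>Bessel for all matrix entries of all classes in F at once. Each entry has squared norm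
  1/k, which is the origin of the factor \<open>k c\<close>.\<close>

lemma fourier_bessel:
  assumes F: "finite F" "F \<subseteq> dual conv chk e" and f: "f \<in> borel_measurable \<Lambda>"
    and f2: "integrable \<Lambda> (\<lambda>x. (cmod (f x))\<^sup>2)"
  shows "(\<Sum>c\<in>F. k c * (hs_norm (dual_index c) (fourier \<Lambda> f c))\<^sup>2) \<le> (\<integral>x. (cmod (f x))\<^sup>2 \<partial>\<Lambda>)"
proof -
  let ?S = "Sigma F (\<lambda>c. dual_index c \<times> dual_index c)"
  let ?\<phi> = "\<lambda>(c, i, j). dual_entry c i j"
  have fin: "finite (dual_index c)" if "c \<in> F" for c using that F finite_dual_index by blast
  have "(\<Sum>c\<in>F. k c * (hs_norm (dual_index c) (fourier \<Lambda> f c))\<^sup>2)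
      = (\<Sum>c\<in>F. \<Sum>ij\<in>dual_index c \<times> dual_index c. (cmod (\<integral>x. f x * cnj (?\<phi> (c, ij) x) \<partial>\<Lambda>))\<^sup>2 / (1 / k c))"
    by (simp add: hs_norm_eq_L2_set L2_set_def sum_nonneg sum_distrib_left fourier_def split_beta mult.commute)
  also have "\<dots> = (\<Sum>s\<in>?S. (cmod (\<integral>x. f x * cnj (?\<phi> s x) \<partial>\<Lambda>))\<^sup>2 / (1 / k (fst s)))"
    using F fin by (subst sum.Sigma) (auto simp: split_beta)
  also have "\<dots> \<le> (\<integral>x. (cmod (f x))\<^sup>2 \<partial>\<Lambda>)"
  proof (rule bessel_inequality[OF _ f _ f2])
    show "(\<integral>x. ?\<phi> s x * cnj (?\<phi> t x) \<partial>\<Lambda>) = (if s = t then complex_of_real (1 / k (fst s)) else 0)"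
      if st: "s \<in> ?S" "t \<in> ?S" for s t
    proof -
      obtain c i j c' m l where [simp]: "s = (c, i, j)" "t = (c', m, l)" by (metis prod.exhaust)
      have "c \<in> dual conv chk e" "c' \<in> dual conv chk e" using st F(2) by auto
      with st show ?thesis using hyper by (simp add: hyperdimension_def)
    qed
  qed (use F fin k_pos in \<open>auto intro!: dual_entry_measurable integrable_dual_entry_sq simp: subset_iff\<close>)
  finally show ?thesis .
qed

lemma integrable_fourier:
  assumes "c \<in> dual conv chk e" "i \<in> dual_index c" "j \<in> dual_index c" and f: "integrable \<Lambda> f"
  shows "integrable \<Lambda> (\<lambda>x. f x * cnj (dual_entry c i j x))"
proof (rule Bochner_Integration.integrable_bound[OF f])
  have [measurable]: "dual_entry c i j \<in> borel_measurable \<Lambda>" "f \<in> borel_measurable \<Lambda>"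
    using dual_entry_measurable assms by auto
  show "(\<lambda>x. f x * cnj (dual_entry c i j x)) \<in> borel_measurable \<Lambda>" by measurable
  show "AE x in \<Lambda>. norm (f x * cnj (dual_entry c i j x)) \<le> norm (f x)"
    using dual_entry_le_1[OF assms(1,3)] by (auto simp: norm_mult intro!: AE_I2 mult_left_le)
qed

lemma hs_norm_fourier_add:
  assumes c: "c \<in> dual conv chk e" and f: "integrable \<Lambda> f" and g: "integrable \<Lambda> g"
  shows "hs_norm (dual_index c) (fourier \<Lambda> (\<lambda>x. f x + g x) c)
    \<le> hs_norm (dual_index c) (fourier \<Lambda> f c) + hs_norm (dual_index c) (fourier \<Lambda> g c)"
proof -
  have "hs_norm (dual_index c) (fourier \<Lambda> (\<lambda>x. f x + g x) c)
      = hs_norm (dual_index c) (\<lambda>i j. fourier \<Lambda> f c i j + fourier \<Lambda> g c i j)"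
    unfolding hs_norm_def fourier_def using integrable_fourier[OF c _ _ f] integrable_fourier[OF c _ _ g]
    by (intro arg_cong[of _ _ sqrt] sum.cong refl) (simp add: distrib_right)
  then show ?thesis using hs_norm_triangle by simp
qed

text \<open>On a probability space the constant 1 covers |f| \<le> 1 and |f|^p the rest. Thus the
  Fourier coefficients of f and of its truncations are genuine integrals, and they add.\<close>

lemma integrable_of_Lp_space:
  assumes "f \<in> Lp_space p \<Lambda>" and "1 \<le> p"
  shows "integrable \<Lambda> f"
proof (rule Bochner_Integration.integrable_bound)
  show "integrable \<Lambda> (\<lambda>x. 1 + cmod (f x) powr p)" "f \<in> borel_measurable \<Lambda>"
    using assms by (auto simp: Lp_space_def)
  have "a \<le> 1 + a powr p" if "0 \<le> a" for a :: real
  proof (cases "a \<le> 1")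
    case False
    then have "a powr 1 \<le> a powr p" using assms(2) by (intro powr_mono) auto
    then show ?thesis using False by simp
  qed (simp add: add_increasing2)
  then show "AE x in \<Lambda>. norm (f x) \<le> norm (1 + cmod (f x) powr p)"
    by (auto intro!: AE_I2)
qed

text \<open>Weak type $(1,1)$: where $\mu_\pi^\beta \|\widehat f(\pi)\|_{HS} / \sqrt{k_\pi} > y$, the bound
  $\|\widehat f(\pi)\|_{HS} \le \sqrt{k_\pi}\, \|f\|_1$ yields $\mu_\pi^{-\beta} \le \|f\|_1 / y$.\<close>

lemma paley_finite:
  fixes \<mu> :: "'a rep set \<Rightarrow> real"
  assumes p: "1 < p" "p < 2" and \<mu>: "\<And>c. c \<in> dual conv chk e \<Longrightarrow> 0 < \<mu> c"
    and summable: "(\<lambda>c. (k c)\<^sup>2 / \<mu> c powr \<beta>) summable_on dual conv chk e"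
    and f: "f \<in> Lp_space p \<Lambda>" and F: "finite F" "F \<subseteq> dual conv chk e"
  shows "(\<Sum>c\<in>F. (k c)\<^sup>2 * \<mu> c powr (\<beta> * (p - 2)) * (hs_norm (dual_index c) (fourier \<Lambda> f c) / sqrt (k c)) powr p)
    \<le> 2 powr p * p * ((\<Sum>\<^sub>\<infinity>c\<in>dual conv chk e. (k c)\<^sup>2 / \<mu> c powr \<beta>) / (p - 1) + 1 / (2 - p))
      * (\<integral>x. cmod (f x) powr p \<partial>\<Lambda>)"
proof -
  define A where "A = (\<Sum>\<^sub>\<infinity>c\<in>dual conv chk e. (k c)\<^sup>2 / \<mu> c powr \<beta>)"
  define w where "w c = (k c)\<^sup>2 * \<mu> c powr (-2 * \<beta>)" for c
  define T where "T h c = \<mu> c powr \<beta> * (hs_norm (dual_index c) (fourier \<Lambda> h c) / sqrt (k c))" for h c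
  have F': "c \<in> dual conv chk e" if "c \<in> F" for c using that F by blast
  have [measurable]: "f \<in> borel_measurable \<Lambda>" using f by (simp add: Lp_space_def)
  have f1: "integrable \<Lambda> f" using integrable_of_Lp_space[OF f] p by simp
  have w0: "0 \<le> w c" for c by (simp add: w_def)
  have T0: "0 \<le> T h c" if "c \<in> F" for h c
    using k_pos[OF F'[OF that]] by (simp add: T_def hs_norm_nonneg)
  have "(\<Sum>c\<in>F. w c * T f c powr p) \<le> 2 powr p * p * (A / (p - 1) + 1 / (2 - p)) * (\<integral>x. cmod (f x) powr p \<partial>\<Lambda>)"
  proof (rule marcinkiewicz_interpolation_1_2[OF sigma_finite_measure_axioms])
    show "integrable \<Lambda> (\<lambda>x. cmod (f x) powr p)" using f by (simp add: Lp_space_def)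
    show "0 \<le> A" unfolding A_def by (intro infsum_nonneg) auto
  next
    fix c :: "'a rep set" and y :: real
    assume c: "c \<in> F"
    let ?h = "\<lambda>x. if y < cmod (f x) then f x else 0" and ?l = "\<lambda>x. if cmod (f x) \<le> y then f x else 0"
    have "integrable \<Lambda> ?h" "integrable \<Lambda> ?l"
      by (auto intro!: Bochner_Integration.integrable_bound[OF f1])
    then have "hs_norm (dual_index c) (fourier \<Lambda> (\<lambda>x. ?h x + ?l x) c)
      \<le> hs_norm (dual_index c) (fourier \<Lambda> ?h c) + hs_norm (dual_index c) (fourier \<Lambda> ?l c)"
      by (intro hs_norm_fourier_add F' c)
    also have "(\<lambda>x. ?h x + ?l x) = f" by auto
    finally show "T f c \<le> T ?h c + T ?l c"
      unfolding T_def distrib_left[symmetric] add_divide_distrib[symmetric]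
      using k_pos[OF F'[OF c]] by (intro mult_left_mono divide_right_mono) auto
  next
    fix h :: "'a \<Rightarrow> complex" and y :: real
    assume h: "integrable \<Lambda> h" and y: "0 < y"
    let ?N = "\<integral>x. cmod (h x) \<partial>\<Lambda>"
    have "(\<Sum>c\<in>{c\<in>F. y < T h c}. w c) \<le> (\<Sum>c\<in>{c\<in>F. y < T h c}. (k c)\<^sup>2 / \<mu> c powr \<beta> * (?N / y))"
    proof (rule sum_mono)
      fix c assume "c \<in> {c\<in>F. y < T h c}"
      then have c: "c \<in> dual conv chk e" and Ty: "y < T h c" using F' by auto
      note pos = k_pos[OF c] \<mu>[OF c]
      have "T h c \<le> \<mu> c powr \<beta> * ?N"
        unfolding T_def using hs_norm_fourier_le[OF c h] pos
        by (intro mult_left_mono) (auto simp: field_simps)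
      then have "y \<le> \<mu> c powr \<beta> * ?N" using Ty by simp
      then have "1 / \<mu> c powr \<beta> \<le> ?N / y" using y pos by (simp add: field_simps)
      \<comment> \<open>One of the two factors \<mu>^(-\<beta>) in the weight is traded for the
        level bound; the other stays and is summed to \<open>A\<close>.\<close>
      then have "(k c)\<^sup>2 / \<mu> c powr \<beta> * (1 / \<mu> c powr \<beta>) \<le> (k c)\<^sup>2 / \<mu> c powr \<beta> * (?N / y)"
        by (intro mult_left_mono) auto
      moreover have "\<mu> c powr (-2 * \<beta>) = 1 / \<mu> c powr \<beta> * (1 / \<mu> c powr \<beta>)"
        using powr_add[of "\<mu> c" "-\<beta>" "-\<beta>"] by (simp add: powr_minus_divide)
      ultimately show "w c \<le> (k c)\<^sup>2 / \<mu> c powr \<beta> * (?N / y)"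
        by (simp add: w_def)
    qed
    also have "\<dots> = (\<Sum>c\<in>{c\<in>F. y < T h c}. (k c)\<^sup>2 / \<mu> c powr \<beta>) * (?N / y)"
      by (rule sum_distrib_right[symmetric])
    also have "\<dots> \<le> A * (?N / y)"
      unfolding A_def using F y
      by (intro mult_right_mono finite_sum_le_infsum[OF summable]) auto
    finally show "(\<Sum>c\<in>{c\<in>F. y < T h c}. w c) \<le> A / y * ?N" by simp
  next
    fix h :: "'a \<Rightarrow> complex" and y :: real
    assume h: "h \<in> borel_measurable \<Lambda>" "integrable \<Lambda> (\<lambda>x. (cmod (h x))\<^sup>2)" and y: "0 < y"
    have "(\<Sum>c\<in>{c\<in>F. y < T h c}. w c) \<le> (\<Sum>c\<in>{c\<in>F. y < T h c}. k c * (hs_norm (dual_index c) (fourier \<Lambda> h c))\<^sup>2 / y\<^sup>2)"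
    proof (rule sum_mono)
      fix c assume "c \<in> {c\<in>F. y < T h c}"
      then have c: "c \<in> dual conv chk e" and Ty: "y < T h c" using F' by auto
      note pos = k_pos[OF c] \<mu>[OF c]
      \<comment> \<open>Chebyshev: on the level set y^2 < T^2, and w T^2 is exactly the term in
        Bessel's inequality.\<close>
      have "w c * y\<^sup>2 \<le> w c * (T h c)\<^sup>2"
        using Ty y w0 by (intro mult_left_mono power_mono) auto
      also have "\<mu> c powr (-2 * \<beta>) * (\<mu> c powr \<beta>)\<^sup>2 = 1"
        using pos by (simp add: powr_minus powr_power)
      then have "w c * (T h c)\<^sup>2 = k c * (hs_norm (dual_index c) (fourier \<Lambda> h c))\<^sup>2"
        using pos by (simp add: w_def T_def power_mult_distrib power_divide power2_eq_square[of "k c"])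
      finally show "w c \<le> k c * (hs_norm (dual_index c) (fourier \<Lambda> h c))\<^sup>2 / y\<^sup>2"
        using y by (simp add: field_simps)
    qed
    also have "\<dots> = (\<Sum>c\<in>{c\<in>F. y < T h c}. k c * (hs_norm (dual_index c) (fourier \<Lambda> h c))\<^sup>2) / y\<^sup>2"
      by (simp add: sum_divide_distrib)
    also have "\<dots> \<le> (\<integral>x. (cmod (h x))\<^sup>2 \<partial>\<Lambda>) / y\<^sup>2"
      using F by (intro divide_right_mono fourier_bessel h) auto
    finally show "(\<Sum>c\<in>{c\<in>F. y < T h c}. w c) \<le> 1 / y\<^sup>2 * (\<integral>x. (cmod (h x))\<^sup>2 \<partial>\<Lambda>)" by simp
  qed (use p F w0 T0 in auto)
  also have "(\<Sum>c\<in>F. w c * T f c powr p)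
      = (\<Sum>c\<in>F. (k c)\<^sup>2 * \<mu> c powr (\<beta> * (p - 2)) * (hs_norm (dual_index c) (fourier \<Lambda> f c) / sqrt (k c)) powr p)"
  proof (rule sum.cong[OF refl])
    fix c assume "c \<in> F"
    note pos = k_pos[OF F'[OF this]]
    have "\<mu> c powr (\<beta> * (p - 2)) = \<mu> c powr (-2 * \<beta>) * \<mu> c powr (\<beta> * p)"
      by (simp add: algebra_simps flip: powr_add)
    moreover have "T f c powr p
      = \<mu> c powr (\<beta> * p) * (hs_norm (dual_index c) (fourier \<Lambda> f c) / sqrt (k c)) powr p"
      unfolding T_def using pos by (subst powr_mult) (auto simp: powr_powr hs_norm_nonneg)
    ultimately show "w c * T f c powr p
      = (k c)\<^sup>2 * \<mu> c powr (\<beta> * (p - 2)) * (hs_norm (dual_index c) (fourier \<Lambda> f c) / sqrt (k c)) powr p"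
      by (simp only: w_def mult.assoc)
  qed
  finally show ?thesis by (simp add: A_def)
qed

end

theorem theorem1p1:
  fixes conv :: "'a::t2_space cmeas \<Rightarrow> 'a cmeas \<Rightarrow> 'a cmeas"
    and chk :: "'a \<Rightarrow> 'a" and e :: 'a
    and \<Lambda> :: "'a measure"
    and k \<mu> :: "'a rep set \<Rightarrow> real"
    and p \<beta> :: real
  assumes "compact_hypergroup conv chk e"
    and "metrizable_space (euclidean :: 'a topology)"
    and "haar_measure conv \<Lambda>"
    and "hyperdimension \<Lambda> (dual conv chk e) k"
    and "1 < p" and "p \<le> 2"
    and "\<forall>c\<in>dual conv chk e. 0 < \<mu> c"
    and "0 \<le> \<beta>"
    and "(\<lambda>c. (k c)\<^sup>2 / \<bar>\<mu> c\<bar> powr \<beta>) summable_on dual conv chk e"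
  shows "\<exists>C>0. \<forall>f\<in>Lp_space p \<Lambda>.
      (\<lambda>c. (k c)\<^sup>2 * \<bar>\<mu> c\<bar> powr (\<beta> * (p - 2)) *
           (hs_norm (dual_index c) (fourier \<Lambda> f c) / sqrt (k c)) powr p)
        summable_on dual conv chk e \<and>
      (\<Sum>\<^sub>\<infinity>c\<in>dual conv chk e. (k c)\<^sup>2 * \<bar>\<mu> c\<bar> powr (\<beta> * (p - 2)) *
           (hs_norm (dual_index c) (fourier \<Lambda> f c) / sqrt (k c)) powr p)
        \<le> C * Lp_norm p \<Lambda> f powr p"
proof -
  let ?D = "dual conv chk e"
  interpret hypergroup_fourier conv chk e \<Lambda> k
    using assms(1,3,4) by (auto simp: hypergroup_fourier_def hypergroup_fourier_axioms_def haar_measure_def)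
  let ?t = "\<lambda>f c. (k c)\<^sup>2 * \<bar>\<mu> c\<bar> powr (\<beta> * (p - 2)) * (hs_norm (dual_index c) (fourier \<Lambda> f c) / sqrt (k c)) powr p"
  have \<mu>: "0 < \<mu> c" if "c \<in> ?D" for c using assms(7) that by blast
  have norm: "Lp_norm p \<Lambda> f powr p = (\<integral>x. cmod (f x) powr p \<partial>\<Lambda>)" for f
    using \<open>1 < p\<close> by (simp add: Lp_norm_def powr_powr)
  \<comment> \<open>The constant is chosen before both f and F; uniformity in F is what yields
    summability below.\<close>
  obtain C where "0 < C" and C: "\<And>f F. f \<in> Lp_space p \<Lambda> \<Longrightarrow> finite F \<Longrightarrow> F \<subseteq> ?D \<Longrightarrow>
      sum (?t f) F \<le> C * Lp_norm p \<Lambda> f powr p"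
  proof (cases "p = 2")
    \<comment> \<open>The interpolation constant blows up at p = 2, but there the power of \<mu> is
      0 and the claim is Bessel's inequality with C = 1.\<close>
    case True
    have "sum (?t f) F \<le> 1 * Lp_norm p \<Lambda> f powr p"
      if f: "f \<in> Lp_space p \<Lambda>" and F: "finite F" "F \<subseteq> ?D" for f F
    proof -
      have "sum (?t f) F = (\<Sum>c\<in>F. k c * (hs_norm (dual_index c) (fourier \<Lambda> f c))\<^sup>2)"
      proof (rule sum.cong[OF refl])
        fix c assume "c \<in> F"
        then have "c \<in> ?D" using F by blast
        then show "?t f c = k c * (hs_norm (dual_index c) (fourier \<Lambda> f c))\<^sup>2"
          using True k_pos[of c] \<mu>[of c] hs_norm_nonneg[of "dual_index c" "fourier \<Lambda> f c"]
          by (simp add: power_divide power2_eq_square[of "k c"])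
      qed
      also have "\<dots> \<le> (\<integral>x. (cmod (f x))\<^sup>2 \<partial>\<Lambda>)"
        using f True by (intro fourier_bessel F) (auto simp: Lp_space_def)
      finally show ?thesis using True unfolding norm by simp
    qed
    then show ?thesis using that[of 1] by simp
  next
    case False
    then have p: "1 < p" "p < 2" using assms(5,6) by auto
    let ?C = "2 powr p * p * ((\<Sum>\<^sub>\<infinity>c\<in>?D. (k c)\<^sup>2 / \<bar>\<mu> c\<bar> powr \<beta>) / (p - 1) + 1 / (2 - p))"
    have "0 \<le> (\<Sum>\<^sub>\<infinity>c\<in>?D. (k c)\<^sup>2 / \<bar>\<mu> c\<bar> powr \<beta>)" by (intro infsum_nonneg) auto
    \<comment> \<open>Strict positivity comes from 1/(2 - p), as the infinite sum is only known to
      be nonnegative.\<close>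
    then have "0 < ?C" using p by (intro mult_pos_pos add_nonneg_pos) auto
    then show ?thesis
      using that[of ?C] paley_finite[OF p, of "\<lambda>c. \<bar>\<mu> c\<bar>" \<beta>] assms(9) \<mu> unfolding norm by fastforce
  qed
  show ?thesis
  proof (intro exI[of _ C] conjI ballI \<open>0 < C\<close>)
    fix f assume f: "f \<in> Lp_space p \<Lambda>"
    \<comment> \<open>\<open>infsum\<close> is 0 on families that are not summable, so only together
      with this does the bound on it carry content.\<close>
    show "?t f summable_on ?D"
      by (rule nonneg_bdd_above_summable_on) (auto intro!: bdd_aboveI2 C[OF f])
    then show "infsum (?t f) ?D \<le> C * Lp_norm p \<Lambda> f powr p"
      by (rule infsum_le_finite_sums) (rule C[OF f])
  qed
qed

end
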